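(* Let $(A,C)_\psi$ be an entwining structure over a field $k$. Then $C_\psi(A)=\bigoplus_{n\ge0}C^n_\psi(A)$ is a graded associative algebra with the product $\cup$ given, for $f\in C^m_\psi(A)$, $g\in C^n_\psi(A)$, by $$(f\cup g)(c,a^1,\ldots,a^{m+n})=f(c_{(1)},a^1_{\alpha_1},\ldots,a^m_{\alpha_m})\,g(c_{(2)}{}^{\alpha_1\ldots\alpha_m},a^{m+1},\ldots,a^{m+n}).$$ Furthermore, $d$ is a degree 1 derivation in this algebra, i.e., for all $f\in C^m_\psi(A)$, $g\in C^n_\psi(A)$, $$d(f\cup g)=df\cup g+(-1)^mf\cup dg.$$
   Context: $k$ is a field, $\otimes=\otimes_k$; algebras are associative and unital, coalgebras are coassociative and counital; $\mathrm{Hom}$ means $k$-linear maps; $V^n=V^{\otimes n}$ (with $V^0=k$); $\Delta(c)=c_{(1)}\otimes c_{(2)}$ and $\epsilon$ are the coproduct and counit of $C$. An entwining structure $(A,C)_\psi$ consists of an algebra $A$, a coalgebra $C$ and a $k$-linear map $\psi:C\otimes A\to A\otimes C$, written $\psi(c\otimes a)=a_\alpha\otimes c^\alpha$ (summation understood; repeated application uses further Greek indices), such that for all $a,a'\in A$, $c\in C$: $(aa')_\alpha\otimes c^\alpha=a_\alpha a'_\beta\otimes c^{\alpha\beta}$; $1_\alpha\otimes c^\alpha=1\otimes c$; $a_\alpha\otimes (c^\alpha)_{(1)}\otimes (c^\alpha)_{(2)}=a_{\beta\alpha}\otimes c_{(1)}{}^\alpha\otimes c_{(2)}{}^\beta$;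 $a_\alpha\epsilon(c^\alpha)=a\epsilon(c)$. $C^n_\psi(A)=\mathrm{Hom}(C\otimes A^n,A)$, $n\ge0$, with coboundary $$df(c,a^1,\ldots,a^{n+1})=a^1_\alpha f(c^\alpha,a^2,\ldots,a^{n+1})+\sum_{i=1}^n(-1)^if(c,a^1,\ldots,a^ia^{i+1},\ldots,a^{n+1})+(-1)^{n+1}f(c,a^1,\ldots,a^n)a^{n+1}$$ for $f\in C_\psi^n(A)$. *)

theory Defs
  imports Complex_Main "HOL-Library.Poly_Mapping" "HOL-Library.Function_Algebras"
begin

section \<open>Vector spaces and linear maps\<close>

text \<open>A vector space presented by carrier, addition and scalar multiplication. It is needed because
  a tensor product over \<open>k\<close> depends on the scalar multiplications of its factors, so that it is
  a quotient set and not a type.\<close>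

record ('k, 'v) vspace =
  vcar :: "'v set"
  vadd :: "'v \<Rightarrow> 'v \<Rightarrow> 'v"
  vscale :: "'k \<Rightarrow> 'v \<Rightarrow> 'v"

definition type_space :: "('k \<Rightarrow> 'v \<Rightarrow> 'v) \<Rightarrow> ('k, 'v::plus) vspace" where
  "type_space s = \<lparr>vcar = UNIV, vadd = (+), vscale = s\<rparr>"

definition klinear :: "('k, 'v) vspace \<Rightarrow> ('k, 'w) vspace \<Rightarrow> ('v \<Rightarrow> 'w) \<Rightarrow> bool" where
  "klinear V W f \<longleftrightarrow>
     (\<forall>x\<in>vcar V. f x \<in> vcar W) \<and>
     (\<forall>x\<in>vcar V. \<forall>y\<in>vcar V. f (vadd V x y) = vadd W (f x) (f y)) \<and>
     (\<forall>r. \<forall>x\<in>vcar V. f (vscale V r x) = vscale W r (f x))"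

text \<open>The space of linear maps from \<open>V\<close> to a space whose carrier is a whole type. The maps are
  normalised to vanish off the carrier of \<open>V\<close>, so that equality in \<open>khom\<close> is equality on the
  carrier, and the vector space operations are the pointwise ones.\<close>

definition khom :: "('k, 'v) vspace \<Rightarrow> ('k \<Rightarrow> 'w \<Rightarrow> 'w) \<Rightarrow> ('v \<Rightarrow> 'w::ab_group_add) set" where
  "khom V s = {f. klinear V (type_space s) f \<and> (\<forall>x. x \<notin> vcar V \<longrightarrow> f x = 0)}"


section \<open>Tensor products\<close>

text \<open>The free vector space on \<open>'x\<close> is \<open>'x \<Rightarrow>\<^sub>0 'k\<close>. A tensor product is the quotient of the
  free vector space on tuples by the subspace spanned by the multilinearity relations; its elements
  are cosets.\<close>

definition fscale :: "'k::field \<Rightarrow> ('x \<Rightarrow>\<^sub>0 'k) \<Rightarrow> ('x \<Rightarrow>\<^sub>0 'k)" where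
  "fscale r p = Poly_Mapping.map ((*) r) p"

abbreviation gen :: "'x \<Rightarrow> ('x \<Rightarrow>\<^sub>0 'k::field)" where
  "gen x \<equiv> Poly_Mapping.single x 1"

definition coset :: "'v::ab_group_add set \<Rightarrow> 'v \<Rightarrow> 'v set" where
  "coset R p = {q. q - p \<in> R}"

definition quotient_space ::
  "'x set \<Rightarrow> ('x \<Rightarrow>\<^sub>0 'k::field) set \<Rightarrow> ('k, ('x \<Rightarrow>\<^sub>0 'k) set) vspace" where
  "quotient_space G R =
     \<lparr>vcar = coset R ` {p. Poly_Mapping.keys p \<subseteq> G},
      vadd = (\<lambda>X Y. {x + y |x y. x \<in> X \<and> y \<in> Y}),
      vscale = (\<lambda>r X. {fscale r x + z |x z. x \<in> X \<and> z \<in> R})\<rparr>"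

text \<open>Linearity relations in one slot of a tuple; \<open>e v\<close> is the tuple with \<open>v\<close> put in that slot.\<close>

definition slot_rels :: "('k::field \<Rightarrow> 'v::ab_group_add \<Rightarrow> 'v) \<Rightarrow> ('v \<Rightarrow> 'x) \<Rightarrow> ('x \<Rightarrow>\<^sub>0 'k) set" where
  "slot_rels s e =
     {gen (e (v + w)) - gen (e v) - gen (e w) |v w. True} \<union>
     {gen (e (s r v)) - fscale r (gen (e v)) |r v. True}"

definition rels2 ::
  "('k::field \<Rightarrow> 'v::ab_group_add \<Rightarrow> 'v) \<Rightarrow> ('k \<Rightarrow> 'w::ab_group_add \<Rightarrow> 'w) \<Rightarrow> ('v \<times> 'w \<Rightarrow>\<^sub>0 'k) set" where
  "rels2 sV sW = module.span fscale
     ((\<Union>w. slot_rels sV (\<lambda>v. (v, w))) \<union> (\<Union>v. slot_rels sW (\<lambda>w. (v, w))))"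

definition rels3 ::
  "('k::field \<Rightarrow> 'u::ab_group_add \<Rightarrow> 'u) \<Rightarrow> ('k \<Rightarrow> 'v::ab_group_add \<Rightarrow> 'v) \<Rightarrow>
   ('k \<Rightarrow> 'w::ab_group_add \<Rightarrow> 'w) \<Rightarrow> ('u \<times> 'v \<times> 'w \<Rightarrow>\<^sub>0 'k) set" where
  "rels3 sU sV sW = module.span fscale
     ((\<Union>v w. slot_rels sU (\<lambda>u. (u, v, w))) \<union>
      (\<Union>u w. slot_rels sV (\<lambda>v. (u, v, w))) \<union>
      (\<Union>u v. slot_rels sW (\<lambda>w. (u, v, w))))"

definition relsn ::
  "('k::field \<Rightarrow> 'c::ab_group_add \<Rightarrow> 'c) \<Rightarrow> ('k \<Rightarrow> 'a::ab_group_add \<Rightarrow> 'a) \<Rightarrow> nat \<Rightarrow>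
   ('c \<times> 'a list \<Rightarrow>\<^sub>0 'k) set" where
  "relsn sC sA n = module.span fscale
     ((\<Union>as\<in>{as. length as = n}. slot_rels sC (\<lambda>c. (c, as))) \<union>
      (\<Union>c. \<Union>(xs, ys)\<in>{(xs, ys). length xs + 1 + length ys = n}.
         slot_rels sA (\<lambda>a. (c, xs @ a # ys))))"

definition tensor2 :: "('k::field \<Rightarrow> 'v::ab_group_add \<Rightarrow> 'v) \<Rightarrow> ('k \<Rightarrow> 'w::ab_group_add \<Rightarrow> 'w) \<Rightarrow>
    ('k, ('v \<times> 'w \<Rightarrow>\<^sub>0 'k) set) vspace" where
  "tensor2 sV sW = quotient_space UNIV (rels2 sV sW)"

text \<open>The space \<open>C \<otimes> A\<^sup>n\<close>. For \<open>n = 0\<close> the only list is empty and this is \<open>C \<otimes> k = C\<close>.\<close>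

definition tensorn :: "('k::field \<Rightarrow> 'c::ab_group_add \<Rightarrow> 'c) \<Rightarrow> ('k \<Rightarrow> 'a::ab_group_add \<Rightarrow> 'a) \<Rightarrow> nat \<Rightarrow>
    ('k, ('c \<times> 'a list \<Rightarrow>\<^sub>0 'k) set) vspace" where
  "tensorn sC sA n = quotient_space {(c, as). length as = n} (relsn sC sA n)"

abbreviation pure2 where
  "pure2 sV sW v w \<equiv> coset (rels2 sV sW) (gen (v, w))"

abbreviation puren where
  "puren sC sA n c as \<equiv> coset (relsn sC sA n) (gen (c, as))"

text \<open>\<open>sw s \<phi> X\<close> is the value of a Sweedler expression: if \<open>X\<close> is the class of a finite sum
  \<open>\<Sum> r\<^sub>i x\<^sub>i\<close> of (multiples of) tuples, it is \<open>\<Sum> r\<^sub>i \<phi>(x\<^sub>i)\<close>, where \<open>s\<close> is the scalar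
  multiplication of the target. The representative is arbitrary: the value does not depend on it
  if \<open>\<phi>\<close> is multilinear. When the target is itself a tensor product, \<open>\<phi>\<close> takes values in the free
  vector space, and the result has to be read modulo the relations of the target.\<close>

definition sw :: "('k::field \<Rightarrow> 'u::ab_group_add \<Rightarrow> 'u) \<Rightarrow> ('x \<Rightarrow> 'u) \<Rightarrow> ('x \<Rightarrow>\<^sub>0 'k) set \<Rightarrow> 'u" where
  "sw s \<phi> X = (let p = (SOME p. p \<in> X) in
     \<Sum>x\<in>Poly_Mapping.keys p. s (Poly_Mapping.lookup p x) (\<phi> x))"


section \<open>Entwining structures\<close>

text \<open>The sort \<open>{ring, monoid_mult}\<close> instead of \<open>ring_1\<close> admits the zero algebra.\<close>

locale k_algebra = vector_space sA
  for sA :: "'k::field \<Rightarrow> 'a::{ring, monoid_mult} \<Rightarrow> 'a" +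
  assumes scale_mult_left: "sA r x * y = sA r (x * y)"
    and scale_mult_right: "x * sA r y = sA r (x * y)"

locale k_coalgebra = vector_space sC
  for sC :: "'k::field \<Rightarrow> 'c::ab_group_add \<Rightarrow> 'c" +
  fixes \<Delta> :: "'c \<Rightarrow> ('c \<times> 'c \<Rightarrow>\<^sub>0 'k) set"
    and \<epsilon> :: "'c \<Rightarrow> 'k"
  assumes comult_linear: "klinear (type_space sC) (tensor2 sC sC) \<Delta>"
    and counit_linear: "klinear (type_space sC) (type_space (*)) \<epsilon>"
    and coassoc:
      "coset (rels3 sC sC sC)
         (sw fscale (\<lambda>(x, y). sw fscale (\<lambda>(x1, x2). gen (x1, x2, y)) (\<Delta> x)) (\<Delta> c)) =
       coset (rels3 sC sC sC)
         (sw fscale (\<lambda>(x, y). sw fscale (\<lambda>(y1, y2). gen (x, y1, y2)) (\<Delta> y)) (\<Delta> c))"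
    and counit_left: "sw sC (\<lambda>(x, y). sC (\<epsilon> x) y) (\<Delta> c) = c"
    and counit_right: "sw sC (\<lambda>(x, y). sC (\<epsilon> y) x) (\<Delta> c) = c"

text \<open>In an iterated expression the upper indices are read from left to right, that is,
  \<open>c\<^sup>\<alpha>\<^sup>\<beta> = (c\<^sup>\<alpha>)\<^sup>\<beta>\<close> and \<open>a\<^sub>\<beta>\<^sub>\<alpha> = (a\<^sub>\<beta>)\<^sub>\<alpha>\<close>.\<close>

locale entwining_structure = A: k_algebra sA + C: k_coalgebra sC \<Delta> \<epsilon>
  for sA :: "'k::field \<Rightarrow> 'a::{ring, monoid_mult} \<Rightarrow> 'a"
    and sC :: "'k \<Rightarrow> 'c::ab_group_add \<Rightarrow> 'c"
    and \<Delta> :: "'c \<Rightarrow> ('c \<times> 'c \<Rightarrow>\<^sub>0 'k) set"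
    and \<epsilon> :: "'c \<Rightarrow> 'k" +
  fixes \<psi> :: "('c \<times> 'a \<Rightarrow>\<^sub>0 'k) set \<Rightarrow> ('a \<times> 'c \<Rightarrow>\<^sub>0 'k) set"
  assumes entwining_linear: "klinear (tensor2 sC sA) (tensor2 sA sC) \<psi>"
    and entwining_mult:
      "\<psi> (pure2 sC sA c (a * a')) =
       coset (rels2 sA sC)
         (sw fscale (\<lambda>(x, y). sw fscale (\<lambda>(x', y'). gen (x * x', y')) (\<psi> (pure2 sC sA y a')))
            (\<psi> (pure2 sC sA c a)))"
    and entwining_one: "\<psi> (pure2 sC sA c 1) = pure2 sA sC 1 c"
    and entwining_comult:
      "coset (rels3 sA sC sC)
         (sw fscale (\<lambda>(x, y). sw fscale (\<lambda>(y1, y2). gen (x, y1, y2)) (\<Delta> y)) (\<psi> (pure2 sC sA c a))) =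
       coset (rels3 sA sC sC)
         (sw fscale (\<lambda>(c1, c2).
            sw fscale (\<lambda>(x, y2). sw fscale (\<lambda>(x', y1). gen (x', y1, y2)) (\<psi> (pure2 sC sA c1 x)))
              (\<psi> (pure2 sC sA c2 a)))
            (\<Delta> c))"
    and entwining_counit:
      "sw sA (\<lambda>(x, y). sA (\<epsilon> y) x) (\<psi> (pure2 sC sA c a)) = sA (\<epsilon> c) a"


section \<open>The cochain algebra\<close>

type_synonym ('k, 'a, 'c) cochain = "('c \<times> 'a list \<Rightarrow>\<^sub>0 'k) set \<Rightarrow> 'a"

definition cochains ::
  "('k::field \<Rightarrow> 'a::{ring, monoid_mult} \<Rightarrow> 'a) \<Rightarrow> ('k \<Rightarrow> 'c::ab_group_add \<Rightarrow> 'c) \<Rightarrow> nat \<Rightarrow>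
   ('k, 'a, 'c) cochain set" where
  "cochains sA sC n = khom (tensorn sC sA n) sA"

text \<open>Linear extension to \<open>C \<otimes> A\<^sup>n\<close> of a multilinear map given on tuples.\<close>

definition lin_ext ::
  "('k::field \<Rightarrow> 'a::{ring, monoid_mult} \<Rightarrow> 'a) \<Rightarrow> ('k \<Rightarrow> 'c::ab_group_add \<Rightarrow> 'c) \<Rightarrow> nat \<Rightarrow>
   ('c \<Rightarrow> 'a list \<Rightarrow> 'a) \<Rightarrow> ('k, 'a, 'c) cochain" where
  "lin_ext sA sC n \<phi> =
     (\<lambda>X. if X \<in> vcar (tensorn sC sA n) then sw sA (\<lambda>(c, as). \<phi> c as) X else 0)"

text \<open>\<open>sw_iter sA sC \<psi> c [a\<^sup>1, \<dots>, a\<^sup>m] h\<close> is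
  \<open>h [a\<^sup>1\<^sub>\<alpha>\<^sub>1, \<dots>, a\<^sup>m\<^sub>\<alpha>\<^sub>m] (c\<^sup>\<alpha>\<^sup>1\<^sup>\<dots>\<^sup>\<alpha>\<^sup>m)\<close>, summation understood.\<close>

fun sw_iter ::
  "('k::field \<Rightarrow> 'a::{ring, monoid_mult} \<Rightarrow> 'a) \<Rightarrow> ('k \<Rightarrow> 'c::ab_group_add \<Rightarrow> 'c) \<Rightarrow>
   (('c \<times> 'a \<Rightarrow>\<^sub>0 'k) set \<Rightarrow> ('a \<times> 'c \<Rightarrow>\<^sub>0 'k) set) \<Rightarrow> 'c \<Rightarrow> 'a list \<Rightarrow> ('a list \<Rightarrow> 'c \<Rightarrow> 'a) \<Rightarrow> 'a" where
  "sw_iter sA sC \<psi> c [] h = h [] c"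
| "sw_iter sA sC \<psi> c (a # as) h =
     sw sA (\<lambda>(x, y). sw_iter sA sC \<psi> y as (\<lambda>bs. h (x # bs))) (\<psi> (pure2 sC sA c a))"

definition cup_formula ::
  "('k::field \<Rightarrow> 'a::{ring, monoid_mult} \<Rightarrow> 'a) \<Rightarrow> ('k \<Rightarrow> 'c::ab_group_add \<Rightarrow> 'c) \<Rightarrow>
   ('c \<Rightarrow> ('c \<times> 'c \<Rightarrow>\<^sub>0 'k) set) \<Rightarrow> (('c \<times> 'a \<Rightarrow>\<^sub>0 'k) set \<Rightarrow> ('a \<times> 'c \<Rightarrow>\<^sub>0 'k) set) \<Rightarrow> nat \<Rightarrow> nat \<Rightarrow>
   ('k, 'a, 'c) cochain \<Rightarrow> ('k, 'a, 'c) cochain \<Rightarrow> 'c \<Rightarrow> 'a list \<Rightarrow> 'a" where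
  "cup_formula sA sC \<Delta> \<psi> m n f g c as =
     sw sA (\<lambda>(c1, c2).
       sw_iter sA sC \<psi> c2 (take m as)
         (\<lambda>bs d. f (puren sC sA m c1 bs) * g (puren sC sA n d (drop m as)))) (\<Delta> c)"

definition cup ::
  "('k::field \<Rightarrow> 'a::{ring, monoid_mult} \<Rightarrow> 'a) \<Rightarrow> ('k \<Rightarrow> 'c::ab_group_add \<Rightarrow> 'c) \<Rightarrow>
   ('c \<Rightarrow> ('c \<times> 'c \<Rightarrow>\<^sub>0 'k) set) \<Rightarrow> (('c \<times> 'a \<Rightarrow>\<^sub>0 'k) set \<Rightarrow> ('a \<times> 'c \<Rightarrow>\<^sub>0 'k) set) \<Rightarrow> nat \<Rightarrow> nat \<Rightarrow>
   ('k, 'a, 'c) cochain \<Rightarrow> ('k, 'a, 'c) cochain \<Rightarrow> ('k, 'a, 'c) cochain" where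
  "cup sA sC \<Delta> \<psi> m n f g = lin_ext sA sC (m + n) (cup_formula sA sC \<Delta> \<psi> m n f g)"

text \<open>In the middle sum \<open>as ! (i - 1)\<close> and \<open>as ! i\<close> are \<open>a\<^sup>i\<close> and \<open>a\<^sup>i\<^sup>+\<^sup>1\<close>.\<close>

definition cobd_formula ::
  "('k::field \<Rightarrow> 'a::{ring, monoid_mult} \<Rightarrow> 'a) \<Rightarrow> ('k \<Rightarrow> 'c::ab_group_add \<Rightarrow> 'c) \<Rightarrow>
   (('c \<times> 'a \<Rightarrow>\<^sub>0 'k) set \<Rightarrow> ('a \<times> 'c \<Rightarrow>\<^sub>0 'k) set) \<Rightarrow> nat \<Rightarrow>
   ('k, 'a, 'c) cochain \<Rightarrow> 'c \<Rightarrow> 'a list \<Rightarrow> 'a" where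
  "cobd_formula sA sC \<psi> n f c as =
     sw sA (\<lambda>(x, y). x * f (puren sC sA n y (tl as))) (\<psi> (pure2 sC sA c (hd as)))
     + (\<Sum>i = 1..n. (-1) ^ i *
          f (puren sC sA n c (take (i - 1) as @ (as ! (i - 1) * as ! i) # drop (i + 1) as)))
     + (-1) ^ (n + 1) * (f (puren sC sA n c (butlast as)) * last as)"

definition cobd ::
  "('k::field \<Rightarrow> 'a::{ring, monoid_mult} \<Rightarrow> 'a) \<Rightarrow> ('k \<Rightarrow> 'c::ab_group_add \<Rightarrow> 'c) \<Rightarrow>
   (('c \<times> 'a \<Rightarrow>\<^sub>0 'k) set \<Rightarrow> ('a \<times> 'c \<Rightarrow>\<^sub>0 'k) set) \<Rightarrow> nat \<Rightarrow>
   ('k, 'a, 'c) cochain \<Rightarrow> ('k, 'a, 'c) cochain" where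
  "cobd sA sC \<psi> n f = lin_ext sA sC (n + 1) (cobd_formula sA sC \<psi> n f)"

definition cochain_scale ::
  "('k::field \<Rightarrow> 'a::{ring, monoid_mult} \<Rightarrow> 'a) \<Rightarrow> 'k \<Rightarrow> ('k, 'a, 'c) cochain \<Rightarrow> ('k, 'a, 'c) cochain" where
  "cochain_scale sA r f = (\<lambda>X. sA r (f X))"


subsection \<open>The direct sum of all degrees\<close>

definition total_cochains ::
  "('k::field \<Rightarrow> 'a::{ring, monoid_mult} \<Rightarrow> 'a) \<Rightarrow> ('k \<Rightarrow> 'c::ab_group_add \<Rightarrow> 'c) \<Rightarrow>
   (nat \<Rightarrow> ('k, 'a, 'c) cochain) set" where
  "total_cochains sA sC = {F. (\<forall>n. F n \<in> cochains sA sC n) \<and> finite {n. F n \<noteq> 0}}"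

definition homog ::
  "('k::field \<Rightarrow> 'a::{ring, monoid_mult} \<Rightarrow> 'a) \<Rightarrow> ('k \<Rightarrow> 'c::ab_group_add \<Rightarrow> 'c) \<Rightarrow> nat \<Rightarrow>
   (nat \<Rightarrow> ('k, 'a, 'c) cochain) set" where
  "homog sA sC n = {F. F n \<in> cochains sA sC n \<and> (\<forall>i. i \<noteq> n \<longrightarrow> F i = 0)}"

definition total_scale ::
  "('k::field \<Rightarrow> 'a::{ring, monoid_mult} \<Rightarrow> 'a) \<Rightarrow> 'k \<Rightarrow> (nat \<Rightarrow> ('k, 'a, 'c) cochain) \<Rightarrow>
   (nat \<Rightarrow> ('k, 'a, 'c) cochain)" where
  "total_scale sA r F = (\<lambda>n. cochain_scale sA r (F n))"

definition total_cup ::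
  "('k::field \<Rightarrow> 'a::{ring, monoid_mult} \<Rightarrow> 'a) \<Rightarrow> ('k \<Rightarrow> 'c::ab_group_add \<Rightarrow> 'c) \<Rightarrow>
   ('c \<Rightarrow> ('c \<times> 'c \<Rightarrow>\<^sub>0 'k) set) \<Rightarrow> (('c \<times> 'a \<Rightarrow>\<^sub>0 'k) set \<Rightarrow> ('a \<times> 'c \<Rightarrow>\<^sub>0 'k) set) \<Rightarrow>
   (nat \<Rightarrow> ('k, 'a, 'c) cochain) \<Rightarrow> (nat \<Rightarrow> ('k, 'a, 'c) cochain) \<Rightarrow> (nat \<Rightarrow> ('k, 'a, 'c) cochain)" where
  "total_cup sA sC \<Delta> \<psi> F G = (\<lambda>n. \<Sum>i\<le>n. cup sA sC \<Delta> \<psi> i (n - i) (F i) (G (n - i)))"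

definition total_cobd ::
  "('k::field \<Rightarrow> 'a::{ring, monoid_mult} \<Rightarrow> 'a) \<Rightarrow> ('k \<Rightarrow> 'c::ab_group_add \<Rightarrow> 'c) \<Rightarrow>
   (('c \<times> 'a \<Rightarrow>\<^sub>0 'k) set \<Rightarrow> ('a \<times> 'c \<Rightarrow>\<^sub>0 'k) set) \<Rightarrow>
   (nat \<Rightarrow> ('k, 'a, 'c) cochain) \<Rightarrow> (nat \<Rightarrow> ('k, 'a, 'c) cochain)" where
  "total_cobd sA sC \<psi> F = (\<lambda>n. case n of 0 \<Rightarrow> 0 | Suc m \<Rightarrow> cobd sA sC \<psi> m (F m))"


section \<open>Graded algebras and derivations\<close>

definition graded_algebra ::
  "('k::field \<Rightarrow> 'v::ab_group_add \<Rightarrow> 'v) \<Rightarrow> 'v set \<Rightarrow> (nat \<Rightarrow> 'v set) \<Rightarrow> ('v \<Rightarrow> 'v \<Rightarrow> 'v) \<Rightarrow> bool" where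
  "graded_algebra s B H mul \<longleftrightarrow>
     vector_space s \<and> module.subspace s B \<and>
     (\<forall>n. module.subspace s (H n) \<and> H n \<subseteq> B) \<and>
     (\<forall>x\<in>B. \<exists>!F. (\<forall>n. F n \<in> H n) \<and> finite {n. F n \<noteq> 0} \<and> x = (\<Sum>n | F n \<noteq> 0. F n)) \<and>
     (\<forall>x\<in>B. \<forall>y\<in>B. mul x y \<in> B) \<and>
     (\<forall>x\<in>B. \<forall>y\<in>B. \<forall>z\<in>B. mul (x + y) z = mul x z + mul y z \<and> mul x (y + z) = mul x y + mul x z) \<and>
     (\<forall>r. \<forall>x\<in>B. \<forall>y\<in>B. mul (s r x) y = s r (mul x y) \<and> mul x (s r y) = s r (mul x y)) \<and>
     (\<forall>x\<in>B. \<forall>y\<in>B. \<forall>z\<in>B. mul (mul x y) z = mul x (mul y z)) \<and>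
     (\<exists>e\<in>H 0. \<forall>x\<in>B. mul e x = x \<and> mul x e = x) \<and>
     (\<forall>m n. \<forall>x\<in>H m. \<forall>y\<in>H n. mul x y \<in> H (m + n))"

definition degree_one_derivation ::
  "('k::field \<Rightarrow> 'v::ab_group_add \<Rightarrow> 'v) \<Rightarrow> 'v set \<Rightarrow> (nat \<Rightarrow> 'v set) \<Rightarrow> ('v \<Rightarrow> 'v \<Rightarrow> 'v) \<Rightarrow>
   ('v \<Rightarrow> 'v) \<Rightarrow> bool" where
  "degree_one_derivation s B H mul D \<longleftrightarrow>
     (\<forall>x\<in>B. D x \<in> B) \<and>
     (\<forall>x\<in>B. \<forall>y\<in>B. D (x + y) = D x + D y) \<and>
     (\<forall>r. \<forall>x\<in>B. D (s r x) = s r (D x)) \<and>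
     (\<forall>n. \<forall>x\<in>H n. D x \<in> H (n + 1)) \<and>
     (\<forall>m n. \<forall>x\<in>H m. \<forall>y\<in>H n. D (mul x y) = mul (D x) y + s ((-1) ^ m) (mul x (D y)))"

end

theory Submission
  imports Defs
begin

text \<open>
  Cochains of degree \<open>n\<close> are multilinear maps of an element of \<open>C\<close> and a list of \<open>n\<close> elements of
  \<open>A\<close>, and a Sweedler sum with multilinear summand does not depend on the representatives, so that
  the axioms of the entwining structure become rewrite rules between iterated Sweedler sums.
  Iterating the compatibility of \<open>\<psi>\<close> with the coproduct along a list of arguments turns
  the associativity of the cup product into the coassociativity of \<open>\<Delta>\<close>. In the Leibniz
  rule, with \<open>f\<close> of degree \<open>m\<close>, the first face of the cup product of \<open>f\<close> and \<open>g\<close> is that of \<open>d f\<close>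
  because \<open>\<psi>\<close> is compatible with \<open>\<Delta>\<close>, the next \<open>m\<close> faces are those of \<open>d f\<close> because
  \<open>\<psi>\<close> is compatible with the multiplication, and the last face of \<open>d f\<close> cancels the first face
  of \<open>d g\<close>.
\<close>

section \<open>Linear extension from free vector spaces\<close>

text \<open>\<open>sw\<close> evaluates this extension of \<open>\<phi>\<close> at a chosen
  representative. Splitting off the choice leaves an honest linear map on the free vector space, to
  which span arguments apply.\<close>

definition lext :: "('k::field \<Rightarrow> 'u::ab_group_add \<Rightarrow> 'u) \<Rightarrow> ('x \<Rightarrow> 'u) \<Rightarrow> ('x \<Rightarrow>\<^sub>0 'k) \<Rightarrow> 'u" where
  "lext s \<phi> p = (\<Sum>x\<in>Poly_Mapping.keys p. s (Poly_Mapping.lookup p x) (\<phi> x))"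

lemma sw_lext: "sw s \<phi> X = lext s \<phi> (SOME p. p \<in> X)"
  by (simp add: sw_def lext_def Let_def)

lemma lookup_fscale [simp]: "Poly_Mapping.lookup (fscale r p) x = r * Poly_Mapping.lookup p x"
  unfolding fscale_def by (subst Poly_Mapping.map.rep_eq) (simp add: when_def)

global_interpretation free: vector_space "fscale :: 'k::field \<Rightarrow> ('x \<Rightarrow>\<^sub>0 'k) \<Rightarrow> _"
  by unfold_locales (auto intro!: poly_mapping_eqI simp: lookup_add algebra_simps)

context vector_space
begin

text \<open>Keys can disappear through cancellation when elements are added, so additivity is
  computed over a common finite index set; the extra terms have coefficient zero.\<close>

lemma lext_superset:
  assumes "finite S" "Poly_Mapping.keys p \<subseteq> S"
  shows "lext scale \<phi> p = (\<Sum>x\<in>S. scale (Poly_Mapping.lookup p x) (\<phi> x))"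
  unfolding lext_def using assms
  by (intro sum.mono_neutral_left) (auto simp: in_keys_iff)

lemma lext_add: "lext scale \<phi> (p + q) = lext scale \<phi> p + lext scale \<phi> q"
proof -
  let ?S = "Poly_Mapping.keys p \<union> Poly_Mapping.keys q"
  have "lext scale \<phi> r = (\<Sum>x\<in>?S. scale (Poly_Mapping.lookup r x) (\<phi> x))"
    if "Poly_Mapping.keys r \<subseteq> ?S" for r
    using that by (intro lext_superset) auto
  then show ?thesis
    by (simp add: Poly_Mapping.keys_add lookup_add scale_left_distrib sum.distrib)
qed

lemma lext_scale: "lext scale \<phi> (fscale r p) = scale r (lext scale \<phi> p)"
proof -
  have "Poly_Mapping.keys (fscale r p) \<subseteq> Poly_Mapping.keys p"
    by (auto simp: in_keys_iff)
  then have "lext scale \<phi> (fscale r p) =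
      (\<Sum>x\<in>Poly_Mapping.keys p. scale (Poly_Mapping.lookup (fscale r p) x) (\<phi> x))"
    by (intro lext_superset) auto
  then show ?thesis
    by (simp add: lext_def scale_sum_right)
qed

lemma lext_gen [simp]: "lext scale \<phi> (gen x) = \<phi> x"
  by (simp add: lext_def)

lemma lext_zero [simp]: "lext scale \<phi> 0 = 0"
  by (simp add: lext_def)

lemma lext_diff: "lext scale \<phi> (p - q) = lext scale \<phi> p - lext scale \<phi> q"
  using lext_add[of \<phi> "p - q" q] by simp

lemma lext_sum: "lext scale \<phi> (sum f S) = (\<Sum>i\<in>S. lext scale \<phi> (f i))"
  by (induction S rule: infinite_finite_induct) (auto simp: lext_add)

text \<open>Flattens nested Sweedler expressions: the axioms have inner sums with values in a free
  vector space, and a linear extension passes through the outer sum.\<close>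

lemma lext_sw: "lext scale \<phi> (sw fscale g X) = sw scale (\<lambda>x. lext scale \<phi> (g x)) X"
  by (simp add: sw_def Let_def lext_sum lext_scale)

lemma lext_span_zero:
  assumes "\<And>b. b \<in> B \<Longrightarrow> lext scale \<phi> b = 0" and "p \<in> module.span fscale B"
  shows "lext scale \<phi> p = 0"
  using assms(2)
proof (induction rule: free.span_induct)
  case base
  show "free.subspace {p. lext scale \<phi> p = 0}"
    by (rule free.subspaceI) (auto simp: lext_add lext_scale)
next
  case (step x)
  then show ?case by (rule assms(1))
qed

text \<open>The element picked by \<open>SOME\<close> differs from \<open>p\<close> by a member of
  \<open>R\<close>, and the extension vanishes there. This is the independence of the
  representative.\<close>

lemma sw_coset:
  assumes "free.subspace R" and "\<And>p. p \<in> R \<Longrightarrow> lext scale \<phi> p = 0"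
  shows "sw scale \<phi> (coset R p) = lext scale \<phi> p"
proof -
  have "p \<in> coset R p"
    using assms(1) by (simp add: coset_def free.subspace_0)
  then have "(SOME q. q \<in> coset R p) - p \<in> R"
    unfolding coset_def by (metis (mono_tags, lifting) mem_Collect_eq someI_ex)
  then have "lext scale \<phi> ((SOME q. q \<in> coset R p) - p) = 0" by (rule assms(2))
  then show ?thesis by (simp add: sw_lext lext_diff)
qed

text \<open>The device that turns an axiom stated modulo relations into an equation in the target
  space.\<close>

lemma lext_coset_eq:
  assumes "free.subspace R" and "\<And>p. p \<in> R \<Longrightarrow> lext scale \<phi> p = 0"
    and "coset R p = coset R q"
  shows "lext scale \<phi> p = lext scale \<phi> q"
  using assms sw_coset by metis

lemma sw_add: "sw scale (\<lambda>x. \<phi> x + \<phi>' x) X = sw scale \<phi> X + sw scale \<phi>' X"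
  by (simp add: sw_def Let_def scale_right_distrib sum.distrib)

lemma sw_scale: "sw scale (\<lambda>x. scale r (\<phi> x)) X = scale r (sw scale \<phi> X)"
  by (simp add: sw_def Let_def scale_sum_right mult.commute)

text \<open>The representatives of \<open>X\<close> and \<open>Y\<close> are chosen independently of
  each other, so this is an exchange in a finite double sum.\<close>

lemma sw_commute:
  "sw scale (\<lambda>x. sw scale (\<lambda>y. \<phi> x y) Y) X = sw scale (\<lambda>y. sw scale (\<lambda>x. \<phi> x y) X) Y"
  unfolding sw_def Let_def scale_sum_right
  by (subst sum.swap) (simp add: mult.commute)

end


section \<open>Quotient spaces\<close>

lemma coset_eq_iff:
  assumes "free.subspace R"
  shows "coset R p = coset R q \<longleftrightarrow> p - q \<in> R"
proof
  assume "coset R p = coset R q"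
  moreover have "p \<in> coset R p"
    using assms by (simp add: coset_def free.subspace_0)
  ultimately show "p - q \<in> R" by (simp add: coset_def)
next
  assume *: "p - q \<in> R"
  have "x - q \<in> R" if "x - p \<in> R" for x
    using free.subspace_add[OF assms that *] by simp
  moreover have "x - p \<in> R" if "x - q \<in> R" for x
    using free.subspace_diff[OF assms that *] by simp
  ultimately show "coset R p = coset R q" by (auto simp: coset_def)
qed

context
  fixes R :: "('x \<Rightarrow>\<^sub>0 'k::field) set" and G :: "'x set"
  assumes sub: "free.subspace R"
begin

lemma vcar_quotient: "vcar (quotient_space G R) = coset R ` {p. Poly_Mapping.keys p \<subseteq> G}"
  by (simp add: quotient_space_def)

lemma vadd_coset: "vadd (quotient_space G R) (coset R p) (coset R q) = coset R (p + q)"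
proof -
  \<comment> \<open>The splitting is z = (z - q) + q; the second summand lies in the coset of
    \<open>q\<close> because \<open>R\<close> contains 0.\<close>
  have "\<exists>x y. z = x + y \<and> x - p \<in> R \<and> y - q \<in> R" if "z - (p + q) \<in> R" for z
    using that free.subspace_0[OF sub]
    by (intro exI[of _ "z - q"] exI[of _ q]) (simp add: algebra_simps)
  moreover have "x + y - (p + q) \<in> R" if "x - p \<in> R" "y - q \<in> R" for x y
    using free.subspace_add[OF sub that] by (simp add: algebra_simps)
  ultimately show ?thesis
    by (auto simp: quotient_space_def coset_def)
qed

lemma vscale_coset: "vscale (quotient_space G R) r (coset R p) = coset R (fscale r p)"
proof -
  have "\<exists>x z'. z = fscale r x + z' \<and> x - p \<in> R \<and> z' \<in> R" if "z - fscale r p \<in> R" for z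
    using that free.subspace_0[OF sub]
    by (intro exI[of _ p] exI[of _ "z - fscale r p"]) (simp add: algebra_simps)
  moreover have "fscale r x + z - fscale r p \<in> R" if "x - p \<in> R" "z \<in> R" for x z
    using free.subspace_add[OF sub free.subspace_scale[OF sub that(1), of r] that(2)]
    by (simp add: algebra_simps free.scale_right_diff_distrib)
  ultimately show ?thesis
    by (auto simp: quotient_space_def coset_def)
qed

lemma coset_slot_add:
  assumes "slot_rels s e \<subseteq> R"
  shows "coset R (gen (e (v + w))) =
    vadd (quotient_space G R) (coset R (gen (e v))) (coset R (gen (e w)))"
proof -
  have "gen (e (v + w)) - gen (e v) - gen (e w) \<in> R"
    using assms by (auto simp: slot_rels_def)
  then show ?thesis
    by (simp add: vadd_coset coset_eq_iff[OF sub] algebra_simps)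
qed

lemma coset_slot_scale:
  assumes "slot_rels s e \<subseteq> R"
  shows "coset R (gen (e (s r v))) = vscale (quotient_space G R) r (coset R (gen (e v)))"
proof -
  have "gen (e (s r v)) - fscale r (gen (e v)) \<in> R"
    using assms by (auto simp: slot_rels_def)
  then show ?thesis
    by (simp add: vscale_coset coset_eq_iff[OF sub])
qed

text \<open>Existence half of the universal property: an extension that kills the relations descends
  to the quotient.\<close>

lemma klinear_sw:
  assumes "vector_space s" and "\<And>p. p \<in> R \<Longrightarrow> lext s \<phi> p = 0"
    and "\<And>X. X \<in> vcar (quotient_space G R) \<Longrightarrow> f X = sw s \<phi> X"
  shows "klinear (quotient_space G R) (type_space s) f"
proof -
  interpret vector_space s by fact
  have f: "f (coset R p) = lext s \<phi> p" if "Poly_Mapping.keys p \<subseteq> G" for p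
    using that by (subst assms(3)) (auto simp: vcar_quotient sw_coset[OF sub assms(2)])
  have "Poly_Mapping.keys (p + q) \<subseteq> G"
    if "Poly_Mapping.keys p \<subseteq> G" "Poly_Mapping.keys q \<subseteq> G" for p q :: "'x \<Rightarrow>\<^sub>0 'k"
    using that keys_add[of p q] by blast
  moreover have "Poly_Mapping.keys (fscale r p) \<subseteq> G"
    if "Poly_Mapping.keys p \<subseteq> G" for r and p :: "'x \<Rightarrow>\<^sub>0 'k"
    using that by (auto simp: in_keys_iff)
  ultimately show ?thesis
    by (auto simp: klinear_def type_space_def vcar_quotient vadd_coset vscale_coset f
        lext_add lext_scale)
qed

text \<open>Uniqueness half of the universal property: the classes of generators span the
  quotient.\<close>

lemma klinear_lext:
  assumes "vector_space s" and f: "klinear (quotient_space G R) (type_space s) f"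
    and "Poly_Mapping.keys p \<subseteq> G"
  shows "f (coset R p) = lext s (\<lambda>x. f (coset R (gen x))) p"
proof -
  interpret vector_space s by fact
  let ?f = "\<lambda>q. f (coset R q)"
  have add: "?f (q + q') = ?f q + ?f q'"
    if "Poly_Mapping.keys q \<subseteq> G" "Poly_Mapping.keys q' \<subseteq> G" for q q'
    using f that unfolding klinear_def vadd_coset[symmetric]
    by (simp add: type_space_def vcar_quotient)
  have scale: "?f (fscale r q) = s r (?f q)" if "Poly_Mapping.keys q \<subseteq> G" for r q
    using f that unfolding klinear_def vscale_coset[symmetric]
    by (simp add: type_space_def vcar_quotient)
  have zero: "?f 0 = 0" using add[of 0 0] by simp
  let ?t = "\<lambda>x. fscale (Poly_Mapping.lookup p x) (gen x)"
  \<comment> \<open>The induction also keeps the keys inside \<open>G\<close>, since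
    \<open>f\<close> is known to be additive only on the classes of such elements.\<close>
  have "?f (sum ?t S) = (\<Sum>x\<in>S. s (Poly_Mapping.lookup p x) (?f (gen x))) \<and>
      Poly_Mapping.keys (sum ?t S) \<subseteq> G" if "finite S" "S \<subseteq> G" for S
    using that
  proof (induction S)
    case empty
    then show ?case by (simp add: zero)
  next
    case (insert x S)
    have k: "Poly_Mapping.keys (?t x) \<subseteq> G"
      using insert.prems by (auto simp: in_keys_iff lookup_single when_def split: if_splits)
    have "Poly_Mapping.keys (?t x + sum ?t S) \<subseteq> G"
      using keys_add[of "?t x" "sum ?t S"] k insert by auto
    moreover have "?f (?t x + sum ?t S) = ?f (?t x) + ?f (sum ?t S)"
      using k insert by (intro add) auto
    moreover have "?f (?t x) = s (Poly_Mapping.lookup p x) (?f (gen x))"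
      using insert.prems by (intro scale) auto
    ultimately show ?case using insert by simp
  qed
  from this[OF finite_keys assms(3)]
  have "?f (sum ?t (Poly_Mapping.keys p)) = lext s (\<lambda>x. f (coset R (gen x))) p"
    by (simp add: lext_def)
  moreover have "(\<Sum>x\<in>Poly_Mapping.keys p. ?t x) = p"
  proof (rule poly_mapping_eqI)
    fix y
    have "Poly_Mapping.lookup (\<Sum>x\<in>Poly_Mapping.keys p. ?t x) y
        = (\<Sum>x\<in>Poly_Mapping.keys p. Poly_Mapping.lookup (?t x) y)"
      by (rule lookup_sum)
    also have "\<dots> = (\<Sum>x\<in>Poly_Mapping.keys p. if x = y then Poly_Mapping.lookup p x else 0)"
      by (intro sum.cong) (auto simp: lookup_single when_def)
    also have "\<dots> = Poly_Mapping.lookup p y"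
      by (simp add: in_keys_iff)
    finally show "Poly_Mapping.lookup (\<Sum>x\<in>Poly_Mapping.keys p. ?t x) y = Poly_Mapping.lookup p y" .
  qed
  ultimately show ?thesis
    by simp
qed

end


section \<open>Linear maps between types\<close>

text \<open>Counterpart of \<open>klinear\<close> for spaces that fill a whole type; the slots of a
  multilinear map are of this kind, so no carrier conditions arise.\<close>

definition lin :: "('k \<Rightarrow> 'v::plus \<Rightarrow> 'v) \<Rightarrow> ('k \<Rightarrow> 'w::plus \<Rightarrow> 'w) \<Rightarrow> ('v \<Rightarrow> 'w) \<Rightarrow> bool" where
  "lin s t f \<longleftrightarrow> (\<forall>x y. f (x + y) = f x + f y) \<and> (\<forall>r x. f (s r x) = t r (f x))"

lemma linI:
  assumes "\<And>x y. f (x + y) = f x + f y" and "\<And>r x. f (s r x) = t r (f x)"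
  shows "lin s t f"
  using assms by (simp add: lin_def)

lemma lin_add: "lin s t f \<Longrightarrow> f (x + y) = f x + f y"
  and lin_scale: "lin s t f \<Longrightarrow> f (s r x) = t r (f x)"
  by (simp_all add: lin_def)

text \<open>On the relations of a slot the extension takes as values the defects of additivity and
  homogeneity of \<open>\<phi>\<close> in that slot.\<close>

lemma (in vector_space) lext_slot_rels:
  assumes "lin sV scale (\<lambda>v. \<phi> (e v))" and "p \<in> slot_rels sV e"
  shows "lext scale \<phi> p = 0"
  using assms(2) lin_add[OF assms(1)] lin_scale[OF assms(1)]
  by (auto simp: slot_rels_def lext_diff lext_scale)

lemma (in vector_space) lext_rels2:
  assumes "\<And>w. lin sV scale (\<lambda>v. \<phi> v w)" "\<And>v. lin sW scale (\<phi> v)" and "p \<in> rels2 sV sW"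
  shows "lext scale (\<lambda>(v, w). \<phi> v w) p = 0"
  using assms(3) unfolding rels2_def
  by (rule lext_span_zero[rotated]) (use assms(1,2) in \<open>auto intro: lext_slot_rels[rotated]\<close>)

lemma (in vector_space) lext_rels3:
  assumes "\<And>v w. lin sU scale (\<lambda>u. \<phi> u v w)" "\<And>u w. lin sV scale (\<lambda>v. \<phi> u v w)"
    "\<And>u v. lin sW scale (\<phi> u v)" and "p \<in> rels3 sU sV sW"
  shows "lext scale (\<lambda>(u, v, w). \<phi> u v w) p = 0"
  using assms(4) unfolding rels3_def
  by (rule lext_span_zero[rotated]) (use assms(1-3) in \<open>auto intro: lext_slot_rels[rotated]\<close>)

lemma subspace_rels2: "free.subspace (rels2 sV sW)"
  and subspace_rels3: "free.subspace (rels3 sU sV sW)"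
  and subspace_relsn: "free.subspace (relsn sC sA n)"
  by (simp_all add: rels2_def rels3_def relsn_def)


section \<open>Multilinear maps\<close>

text \<open>A slot is addressed by splitting the list around the varying entry, which is the shape
  of the relations in \<open>relsn\<close>.\<close>

definition mlist :: "('k \<Rightarrow> 'a::plus \<Rightarrow> 'a) \<Rightarrow> nat \<Rightarrow> ('a list \<Rightarrow> 'a) \<Rightarrow> bool" where
  "mlist sA n H \<longleftrightarrow>
     (\<forall>xs ys. length xs + 1 + length ys = n \<longrightarrow> lin sA sA (\<lambda>a. H (xs @ a # ys)))"

definition mlin :: "('k \<Rightarrow> 'c::plus \<Rightarrow> 'c) \<Rightarrow> ('k \<Rightarrow> 'a::plus \<Rightarrow> 'a) \<Rightarrow> nat \<Rightarrow>
    ('c \<Rightarrow> 'a list \<Rightarrow> 'a) \<Rightarrow> bool" where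
  "mlin sC sA n F \<longleftrightarrow>
     (\<forall>as. length as = n \<longrightarrow> lin sC sA (\<lambda>c. F c as)) \<and> (\<forall>c. mlist sA n (F c))"

lemma mlist_lin: "mlist sA n H \<Longrightarrow> length xs + 1 + length ys = n \<Longrightarrow> lin sA sA (\<lambda>a. H (xs @ a # ys))"
  by (simp add: mlist_def)

lemma mlist_0 [simp]: "mlist sA 0 H"
  by (simp add: mlist_def)

text \<open>Peels off the first slot, in step with the recursion of \<open>sw_iter\<close> along the
  list.\<close>

lemma mlist_Suc_iff:
  "mlist sA (Suc n) H \<longleftrightarrow>
     (\<forall>a. mlist sA n (\<lambda>as. H (a # as))) \<and> (\<forall>as. length as = n \<longrightarrow> lin sA sA (\<lambda>a. H (a # as)))"
  (is "?L \<longleftrightarrow> ?R")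
proof
  assume L: ?L
  have "lin sA sA (\<lambda>b. H (a # xs @ b # ys))" if "length xs + 1 + length ys = n" for a xs ys
    using mlist_lin[OF L, of "a # xs" ys] that by simp
  moreover have "lin sA sA (\<lambda>b. H (b # ys))" if "length ys = n" for ys
    using mlist_lin[OF L, of "[]" ys] that by simp
  ultimately show ?R by (simp add: mlist_def)
next
  assume R: ?R
  show ?L
    unfolding mlist_def
  proof (intro allI impI)
    fix xs ys :: "'b list"
    assume "length xs + 1 + length ys = Suc n"
    then show "lin sA sA (\<lambda>a. H (xs @ a # ys))"
      using R by (cases xs) (auto simp: mlist_def)
  qed
qed

text \<open>Every slot lies in one of the two parts. The cup product needs this because its first
  \<open>m\<close> and last \<open>n\<close> arguments enter in different ways.\<close>

lemma mlist_append:
  assumes "\<And>ys. length ys = n \<Longrightarrow> mlist sA m (\<lambda>xs. H (xs @ ys))"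
    and "\<And>xs. length xs = m \<Longrightarrow> mlist sA n (\<lambda>ys. H (xs @ ys))"
  shows "mlist sA (m + n) H"
  using assms
proof (induction m arbitrary: H)
  case 0
  then show ?case by simp
next
  case (Suc m)
  have "mlist sA (m + n) (\<lambda>as. H (a # as))" for a
  proof (rule Suc.IH)
    show "mlist sA m (\<lambda>xs. H (a # xs @ ys))" if "length ys = n" for ys
      using Suc.prems(1)[OF that] by (simp add: mlist_Suc_iff)
    show "mlist sA n (\<lambda>ys. H (a # xs @ ys))" if "length xs = m" for xs
      using Suc.prems(2)[of "a # xs"] that by simp
  qed
  moreover have "lin sA sA (\<lambda>a. H (a # as))" if "length as = m + n" for as
    using Suc.prems(1)[of "drop m as"] that
    by (simp add: mlist_Suc_iff) (metis append_take_drop_id length_take min.absorb2 le_add1)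
  ultimately show ?case by (simp add: mlist_Suc_iff)
qed

lemma mlin_lin: "mlin sC sA n F \<Longrightarrow> length as = n \<Longrightarrow> lin sC sA (\<lambda>c. F c as)"
  and mlin_mlist: "mlin sC sA n F \<Longrightarrow> mlist sA n (F c)"
  by (simp_all add: mlin_def)

lemma mlin_Suc_head: "mlin sC sA (Suc n) F \<Longrightarrow> length as = n \<Longrightarrow> lin sA sA (\<lambda>a. F c (a # as))"
  and mlin_Suc_tail: "mlin sC sA (Suc n) F \<Longrightarrow> mlin sC sA n (\<lambda>c as. F c (a # as))"
  by (simp_all add: mlin_def mlist_Suc_iff)

context vector_space
begin

lemma lin_plus: "lin s scale f \<Longrightarrow> lin s scale g \<Longrightarrow> lin s scale (\<lambda>z. f z + g z)"
  by (simp add: lin_def scale_right_distrib)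

lemma lin_zero: "lin s scale (\<lambda>z. 0)"
  by (simp add: lin_def)

lemma lin_sum: "(\<And>i. i \<in> S \<Longrightarrow> lin s scale (f i)) \<Longrightarrow> lin s scale (\<lambda>z. \<Sum>i\<in>S. f i z)"
  by (induction S rule: infinite_finite_induct) (auto intro: lin_zero lin_plus)

text \<open>The coset does not depend on the varying argument, so one fixed representative serves
  for all \<open>z\<close> and linearity is inherited term by term.\<close>

lemma lin_sw:
  assumes "\<And>x. lin s scale (\<lambda>z. \<phi> z x)"
  shows "lin s scale (\<lambda>z. sw scale (\<phi> z) X)"
proof -
  have "\<phi> (y + z) = (\<lambda>x. \<phi> y x + \<phi> z x)" "\<phi> (s r z) = (\<lambda>x. scale r (\<phi> z x))" for y z r
    using lin_add[OF assms] lin_scale[OF assms] by auto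
  then show ?thesis by (simp add: lin_def sw_add sw_scale)
qed

lemma lin_id: "lin scale scale (\<lambda>z. z)"
  by (simp add: lin_def)

lemma lin_scale_right: "lin s scale f \<Longrightarrow> lin s scale (\<lambda>z. scale r (f z))"
  by (simp add: lin_def scale_right_distrib mult.commute)

lemma lin_scale_left: "lin s (*) f \<Longrightarrow> lin s scale (\<lambda>z. scale (f z) v)"
  by (simp add: lin_def scale_left_distrib)

lemma lin_apply_sw:
  assumes "vector_space s" "lin scale s h"
  shows "h (sw scale \<phi> X) = sw s (\<lambda>x. h (\<phi> x)) X"
proof -
  interpret T: vector_space s by fact
  have 0: "h 0 = 0" using lin_add[OF assms(2), of 0 0] by simp
  have "h (sum f S) = (\<Sum>x\<in>S. h (f x))" for f and S :: "'z set"
    by (induction S rule: infinite_finite_induct) (simp_all add: 0 lin_add[OF assms(2)])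
  note h_sum = this
  show ?thesis
    by (simp add: sw_def Let_def h_sum lin_scale[OF assms(2)])
qed

end

context k_algebra
begin

lemma lin_mult_left: "lin s sA f \<Longrightarrow> lin s sA (\<lambda>z. f z * k)"
  and lin_mult_right: "lin s sA f \<Longrightarrow> lin s sA (\<lambda>z. k * f z)"
  by (simp_all add: lin_def algebra_simps scale_mult_left scale_mult_right)

text \<open>Turns the signs of the coboundary formula, which are elements of the algebra, into
  scalars, which pass through every linear map.\<close>

lemma minus_one_power_mult: "(- 1) ^ i * x = sA ((- 1) ^ i) x"
  by (induction i) (simp_all add: mult.assoc)

end


section \<open>Calculus of Sweedler sums in an entwining structure\<close>

context entwining_structure
begin

text \<open>\<open>delta_sum\<close> and \<open>psi_sum\<close> stand for
  \<open>\<phi>(c_(1), c_(2))\<close> and \<open>\<phi>(a_\<alpha>, c^\<alpha>)\<close> with values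
  in the algebra; later proofs work with them instead of with cosets.\<close>

definition delta_sum :: "'c \<Rightarrow> ('c \<Rightarrow> 'c \<Rightarrow> 'a) \<Rightarrow> 'a" where
  "delta_sum c \<phi> = sw sA (\<lambda>(x, y). \<phi> x y) (\<Delta> c)"

definition psi_sum :: "'c \<Rightarrow> 'a \<Rightarrow> ('a \<Rightarrow> 'c \<Rightarrow> 'a) \<Rightarrow> 'a" where
  "psi_sum c a \<phi> = sw sA (\<lambda>(x, y). \<phi> x y) (\<psi> (pure2 sC sA c a))"

abbreviation iter_sum :: "'c \<Rightarrow> 'a list \<Rightarrow> ('a list \<Rightarrow> 'c \<Rightarrow> 'a) \<Rightarrow> 'a" where
  "iter_sum \<equiv> sw_iter sA sC \<psi>"

section \<open>Linearity of Sweedler sums in their arguments and in parameters of the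
  summand\<close>

lemma sw_rels2_vadd:
  assumes "\<And>w. lin sV sA (\<lambda>v. \<phi> v w)" "\<And>v. lin sW sA (\<phi> v)"
    and "X \<in> vcar (tensor2 sV sW)" "Y \<in> vcar (tensor2 sV sW)"
  shows "sw sA (\<lambda>(v, w). \<phi> v w) (vadd (tensor2 sV sW) X Y) =
      sw sA (\<lambda>(v, w). \<phi> v w) X + sw sA (\<lambda>(v, w). \<phi> v w) Y"
    and "sw sA (\<lambda>(v, w). \<phi> v w) (vscale (tensor2 sV sW) r X) = sA r (sw sA (\<lambda>(v, w). \<phi> v w) X)"
  using klinear_sw[where G = UNIV, OF subspace_rels2 A.vector_space_axioms
      A.lext_rels2[OF assms(1,2)] refl] assms(3,4)
  by (simp_all add: klinear_def tensor2_def type_space_def)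

text \<open>A bilinear summand factors through the tensor product, and \<open>\<Delta>\<close> is
  linear. In \<open>lin_delta_sum\<close>, by contrast, the coset stays fixed and the summand
  varies.\<close>

lemma lin_delta_sum_arg:
  assumes "\<And>y. lin sC sA (\<lambda>x. \<phi> x y)" "\<And>x. lin sC sA (\<phi> x)"
  shows "lin sC sA (\<lambda>c. delta_sum c \<phi>)"
proof (rule linI)
  have *: "\<Delta> c \<in> vcar (tensor2 sC sC)" for c
    using C.comult_linear by (simp add: klinear_def type_space_def)
  show "delta_sum (x + y) \<phi> = delta_sum x \<phi> + delta_sum y \<phi>" for x y
    using C.comult_linear sw_rels2_vadd(1)[OF assms * *]
    by (simp add: delta_sum_def klinear_def type_space_def)
  show "delta_sum (sC r x) \<phi> = sA r (delta_sum x \<phi>)" for r x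
    using C.comult_linear sw_rels2_vadd(2)[OF assms * *]
    by (simp add: delta_sum_def klinear_def type_space_def)
qed

lemma slot_rels_rels2:
  "slot_rels sV (\<lambda>v. (v, w)) \<subseteq> rels2 sV sW" "slot_rels sW (\<lambda>w. (v, w)) \<subseteq> rels2 sV sW"
  unfolding rels2_def by (rule order_trans[OF _ free.span_superset]; blast)+

text \<open>One argument for both slots of \<open>\<psi>\<close>: \<open>e v\<close> is the pair
  with \<open>v\<close> in the varying slot, its class is linear in \<open>v\<close>, and then
  \<open>\<psi>\<close> and the bilinear summand are applied.\<close>

lemma lin_psi_sum_slot:
  assumes "\<And>y. lin sA sA (\<lambda>x. \<phi> x y)" "\<And>x. lin sC sA (\<phi> x)"
    and "slot_rels s e \<subseteq> rels2 sC sA"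
  shows "lin s sA (\<lambda>v. sw sA (\<lambda>(x, y). \<phi> x y) (\<psi> (coset (rels2 sC sA) (gen (e v)))))"
proof (rule linI)
  let ?p = "\<lambda>v. coset (rels2 sC sA) (gen (e v))"
  have p: "?p v \<in> vcar (tensor2 sC sA)" for v
    by (simp add: tensor2_def quotient_space_def)
  then have q: "\<psi> (?p v) \<in> vcar (tensor2 sA sC)" for v
    using entwining_linear by (simp add: klinear_def)
  show "sw sA (\<lambda>(x, y). \<phi> x y) (\<psi> (?p (v + w))) =
      sw sA (\<lambda>(x, y). \<phi> x y) (\<psi> (?p v)) + sw sA (\<lambda>(x, y). \<phi> x y) (\<psi> (?p w))" for v w
    using entwining_linear sw_rels2_vadd(1)[OF assms(1,2) q q] p[unfolded tensor2_def]
    by (simp add: coset_slot_add[where G = UNIV, OF subspace_rels2 assms(3)] tensor2_def klinear_def)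
  show "sw sA (\<lambda>(x, y). \<phi> x y) (\<psi> (?p (s r v))) = sA r (sw sA (\<lambda>(x, y). \<phi> x y) (\<psi> (?p v)))" for r v
    using entwining_linear sw_rels2_vadd(2)[OF assms(1,2) q q] p[unfolded tensor2_def]
    by (simp add: coset_slot_scale[where G = UNIV, OF subspace_rels2 assms(3)] tensor2_def klinear_def)
qed

lemma lin_psi_sum_coalg:
  assumes "\<And>y. lin sA sA (\<lambda>x. \<phi> x y)" "\<And>x. lin sC sA (\<phi> x)"
  shows "lin sC sA (\<lambda>c. psi_sum c a \<phi>)"
  unfolding psi_sum_def
  by (rule lin_psi_sum_slot[where e = "\<lambda>c. (c, a)", OF assms slot_rels_rels2(1)])

lemma lin_psi_sum_alg:
  assumes "\<And>y. lin sA sA (\<lambda>x. \<phi> x y)" "\<And>x. lin sC sA (\<phi> x)"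
  shows "lin sA sA (\<lambda>a. psi_sum c a \<phi>)"
  unfolding psi_sum_def
  by (rule lin_psi_sum_slot[where e = "\<lambda>a. (c, a)", OF assms slot_rels_rels2(2)])

lemma lin_delta_sum: "(\<And>x y. lin s sA (\<lambda>z. \<phi> z x y)) \<Longrightarrow> lin s sA (\<lambda>z. delta_sum c (\<phi> z))"
  unfolding delta_sum_def by (rule A.lin_sw) auto

lemma lin_psi_sum: "(\<And>x y. lin s sA (\<lambda>z. \<phi> z x y)) \<Longrightarrow> lin s sA (\<lambda>z. psi_sum c a (\<phi> z))"
  unfolding psi_sum_def by (rule A.lin_sw) auto

lemma lin_apply_delta_sum: "lin sA sA h \<Longrightarrow> h (delta_sum c \<phi>) = delta_sum c (\<lambda>x y. h (\<phi> x y))"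
  unfolding delta_sum_def by (subst A.lin_apply_sw[OF A.vector_space_axioms]) (auto simp: split_def)

lemma lin_apply_psi_sum: "lin sA sA h \<Longrightarrow> h (psi_sum c a \<phi>) = psi_sum c a (\<lambda>x y. h (\<phi> x y))"
  unfolding psi_sum_def by (subst A.lin_apply_sw[OF A.vector_space_axioms]) (auto simp: split_def)

lemmas mult_delta_sum = lin_apply_delta_sum[OF A.lin_mult_left[OF A.lin_id]]
  lin_apply_delta_sum[OF A.lin_mult_right[OF A.lin_id]]
lemmas mult_psi_sum = lin_apply_psi_sum[OF A.lin_mult_left[OF A.lin_id]]
  lin_apply_psi_sum[OF A.lin_mult_right[OF A.lin_id]]

lemma delta_psi_commute:
  "delta_sum c (\<lambda>x y. psi_sum d a (\<phi> x y)) = psi_sum d a (\<lambda>u v. delta_sum c (\<lambda>x y. \<phi> x y u v))"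
  unfolding delta_sum_def psi_sum_def split_def by (rule A.sw_commute)

lemma psi_psi_commute:
  "psi_sum c a (\<lambda>x y. psi_sum d b (\<phi> x y)) = psi_sum d b (\<lambda>u v. psi_sum c a (\<lambda>x y. \<phi> x y u v))"
  unfolding psi_sum_def split_def by (rule A.sw_commute)

section \<open>The axioms as identities between Sweedler sums\<close>

text \<open>The axiom is an equality of classes modulo \<open>rels3\<close>, so it survives
  evaluation by any trilinear map. The compatibility of \<open>\<psi>\<close> with products and
  coproducts is converted in the same way.\<close>

lemma delta_sum_coassoc:
  assumes "\<And>y z. lin sC sA (\<lambda>x. \<phi> x y z)" "\<And>x z. lin sC sA (\<lambda>y. \<phi> x y z)"
    "\<And>x y. lin sC sA (\<phi> x y)"
  shows "delta_sum c (\<lambda>x y. delta_sum x (\<lambda>x1 x2. \<phi> x1 x2 y)) =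
    delta_sum c (\<lambda>x y. delta_sum y (\<lambda>y1 y2. \<phi> x y1 y2))"
  using A.lext_coset_eq[OF subspace_rels3 A.lext_rels3[OF assms] C.coassoc]
  by (simp add: A.lext_sw split_def delta_sum_def)

lemma delta_sum_counit:
  assumes "lin sC sA h"
  shows "delta_sum c (\<lambda>x y. sA (\<epsilon> x) (h y)) = h c" "delta_sum c (\<lambda>x y. sA (\<epsilon> y) (h x)) = h c"
  using C.lin_apply_sw[OF A.vector_space_axioms assms, of "\<lambda>(x, y). sC (\<epsilon> x) y" "\<Delta> c"]
    C.lin_apply_sw[OF A.vector_space_axioms assms, of "\<lambda>(x, y). sC (\<epsilon> y) x" "\<Delta> c"]
  by (simp_all add: C.counit_left[unfolded split_def] C.counit_right[unfolded split_def]
      delta_sum_def split_def lin_scale[OF assms])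

lemma psi_sum_mult:
  assumes "\<And>y. lin sA sA (\<lambda>x. \<phi> x y)" "\<And>x. lin sC sA (\<phi> x)"
  shows "psi_sum c (a * a') \<phi> = psi_sum c a (\<lambda>x y. psi_sum y a' (\<lambda>x' y'. \<phi> (x * x') y'))"
  unfolding psi_sum_def entwining_mult
  by (subst A.sw_coset[OF subspace_rels2 A.lext_rels2[OF assms]])
    (simp_all add: A.lext_sw split_def)

lemma psi_sum_comult:
  assumes "\<And>y z. lin sA sA (\<lambda>x. \<phi> x y z)" "\<And>x z. lin sC sA (\<lambda>y. \<phi> x y z)"
    "\<And>x y. lin sC sA (\<phi> x y)"
  shows "psi_sum c a (\<lambda>x y. delta_sum y (\<lambda>y1 y2. \<phi> x y1 y2)) =
    delta_sum c (\<lambda>c1 c2. psi_sum c2 a (\<lambda>x y2. psi_sum c1 x (\<lambda>x' y1. \<phi> x' y1 y2)))"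
  using A.lext_coset_eq[OF subspace_rels3 A.lext_rels3[OF assms] entwining_comult]
  by (simp add: A.lext_sw split_def delta_sum_def psi_sum_def)

lemma psi_sum_counit:
  assumes "lin sA sA h"
  shows "psi_sum c a (\<lambda>x y. sA (\<epsilon> y) (h x)) = sA (\<epsilon> c) (h a)"
  using A.lin_apply_sw[OF A.vector_space_axioms assms, of "\<lambda>(x, y). sA (\<epsilon> y) x"
      "\<psi> (pure2 sC sA c a)"]
  by (simp add: entwining_counit[unfolded split_def] psi_sum_def split_def lin_scale[OF assms])

section \<open>Iterated sums along a list of arguments\<close>

text \<open>Replaces the defining equation of \<open>sw_iter\<close> as rewrite rule, so that the
  facts on \<open>psi_sum\<close> apply after each unfolding.\<close>

lemma iter_sum_Cons: "iter_sum c (a # as) h = psi_sum c a (\<lambda>x y. iter_sum y as (\<lambda>bs. h (x # bs)))"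
  by (simp add: psi_sum_def)

declare sw_iter.simps(2) [simp del] iter_sum_Cons [simp]

text \<open>The summand is evaluated only at lists as long as \<open>as\<close>, and these are the
  lists on which multilinear maps are controlled.\<close>

lemma iter_sum_cong:
  "(\<And>bs d. length bs = length as \<Longrightarrow> h bs d = h' bs d) \<Longrightarrow> iter_sum c as h = iter_sum c as h'"
proof (induction as arbitrary: c h h')
  case (Cons a as)
  have "iter_sum y as (\<lambda>bs. h (x # bs)) = iter_sum y as (\<lambda>bs. h' (x # bs))" for x y
    by (rule Cons.IH) (simp add: Cons.prems)
  then show ?case by simp
qed simp

lemma iter_sum_append:
  "iter_sum c (as @ bs) h = iter_sum c as (\<lambda>xs d. iter_sum d bs (\<lambda>ys. h (xs @ ys)))"
  by (induction as arbitrary: c h) simp_all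

lemma lin_iter_sum:
  "(\<And>bs d. length bs = length as \<Longrightarrow> lin s sA (\<lambda>z. h z bs d)) \<Longrightarrow>
    lin s sA (\<lambda>z. iter_sum c as (h z))"
proof (induction as arbitrary: c h)
  case Nil
  then show ?case by simp
next
  case (Cons a as)
  have "lin s sA (\<lambda>z. iter_sum y as (\<lambda>bs. h z (x # bs)))" for x y
    by (rule Cons.IH) (simp add: Cons.prems)
  then show ?case by (auto intro: lin_psi_sum)
qed

lemma lin_apply_iter_sum:
  "lin sA sA h \<Longrightarrow> h (iter_sum c as \<phi>) = iter_sum c as (\<lambda>x y. h (\<phi> x y))"
  by (induction as arbitrary: c \<phi>) (simp_all add: lin_apply_psi_sum)

lemmas mult_iter_sum = lin_apply_iter_sum[OF A.lin_mult_left[OF A.lin_id]]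
  lin_apply_iter_sum[OF A.lin_mult_right[OF A.lin_id]]

text \<open>Each application of \<open>\<psi>\<close> is linear in both arguments, so multilinearity
  of the summand passes through the sums by induction on the list.\<close>

lemma mlin_iter_sum:
  "mlin sC sA n (\<lambda>d bs. h bs d) \<Longrightarrow> mlin sC sA n (\<lambda>c as. iter_sum c as h)"
proof (induction n arbitrary: h)
  case 0
  then show ?case by (simp add: mlin_def)
next
  case (Suc n)
  have IH: "mlin sC sA n (\<lambda>c as. iter_sum c as (\<lambda>bs. h (x # bs)))" for x
    by (intro Suc.IH mlin_Suc_tail Suc.prems)
  have x: "lin sA sA (\<lambda>x. iter_sum y as (\<lambda>bs. h (x # bs)))" if "length as = n" for as y
    using that by (auto intro!: lin_iter_sum mlin_Suc_head[OF Suc.prems])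
  have y: "lin sC sA (\<lambda>y. iter_sum y as (\<lambda>bs. h (x # bs)))" if "length as = n" for as x
    using mlin_lin[OF IH that] .
  show ?case
    unfolding mlin_def mlist_Suc_iff
  proof (intro conjI allI impI)
    fix as :: "'a list" assume "length as = Suc n"
    then obtain a bs where as: "as = a # bs" "length bs = n" by (cases as) auto
    then show "lin sC sA (\<lambda>c. iter_sum c as h)"
      by (simp add: lin_psi_sum_coalg x y)
  next
    fix c a
    show "mlist sA n (\<lambda>as. iter_sum c (a # as) h)"
      unfolding mlist_def using mlin_mlist[OF IH]
      by (auto intro!: lin_psi_sum mlist_lin)
  next
    fix c and as :: "'a list" assume "length as = n"
    then show "lin sA sA (\<lambda>a. iter_sum c (a # as) h)"
      by (simp add: lin_psi_sum_alg x y)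
  qed
qed

section \<open>Exchange of independent sums\<close>

lemma psi_iter_commute:
  "psi_sum c a (\<lambda>x y. iter_sum d bs (\<phi> x y)) = iter_sum d bs (\<lambda>us v. psi_sum c a (\<lambda>x y. \<phi> x y us v))"
proof (induction bs arbitrary: d \<phi>)
  case (Cons b bs)
  show ?case
    by (simp add: psi_psi_commute[of c a] Cons)
qed simp

lemma delta_iter_commute:
  "delta_sum c (\<lambda>x y. iter_sum d bs (\<phi> x y)) = iter_sum d bs (\<lambda>us v. delta_sum c (\<lambda>x y. \<phi> x y us v))"
proof (induction bs arbitrary: d \<phi>)
  case (Cons b bs)
  show ?case
    by (simp add: delta_psi_commute[of c] Cons)
qed simp

lemma iter_iter_commute:
  "iter_sum c as (\<lambda>xs y. iter_sum d bs (\<phi> xs y)) =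
    iter_sum d bs (\<lambda>us v. iter_sum c as (\<lambda>xs y. \<phi> xs y us v))"
proof (induction as arbitrary: c \<phi>)
  case (Cons a as)
  show ?case
    by (simp add: psi_iter_commute[symmetric] Cons)
qed simp

text \<open>Since \<open>a\<^sub>\<beta>\<^sub>\<alpha>\<close> occurs in the compatibility of \<open>\<psi>\<close> with \<open>\<Delta>\<close>, it is the second
  leg of the coproduct that meets the arguments first.\<close>

lemma iter_sum_comult:
  assumes "\<And>ys d2. length ys = n \<Longrightarrow> lin sC sA (\<lambda>d1. \<phi> ys d1 d2)"
    and "\<And>ys d1. length ys = n \<Longrightarrow> lin sC sA (\<lambda>d2. \<phi> ys d1 d2)"
    and "\<And>d1 d2. mlist sA n (\<lambda>ys. \<phi> ys d1 d2)"
    and "length as = n"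
  shows "iter_sum c as (\<lambda>ys d. delta_sum d (\<phi> ys)) =
    delta_sum c (\<lambda>c1 c2. iter_sum c2 as (\<lambda>xs d2. iter_sum c1 xs (\<lambda>ys d1. \<phi> ys d1 d2)))"
  using assms
proof (induction as arbitrary: n \<phi> c)
  case Nil
  then show ?case by simp
next
  case (Cons a as)
  then obtain m where n: "n = Suc m" "length as = m" by auto
  have m1: "mlin sC sA m (\<lambda>d ys. \<phi> (x # ys) d d2)"
    and m2: "mlin sC sA m (\<lambda>d ys. \<phi> (x # ys) d1 d)" for x d1 d2
    using Cons.prems n by (auto simp: mlin_def mlist_Suc_iff)
  \<comment> \<open>What remains once the first argument is fixed to \<open>x\<close>; it is
    trilinear, so that \<open>psi_sum_comult\<close> can be applied to it.\<close>
  let ?\<Phi> = "\<lambda>x y1 y2. iter_sum y2 as (\<lambda>xs d2. iter_sum y1 xs (\<lambda>ys d1. \<phi> (x # ys) d1 d2))"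
  have IH: "iter_sum y as (\<lambda>ys d. delta_sum d (\<phi> (x # ys))) = delta_sum y (?\<Phi> x)" for x y
    using m1 m2 n by (intro Cons.IH[of m]) (auto intro: mlin_lin simp: mlin_def)
  have "lin sA sA (\<lambda>x. ?\<Phi> x y1 y2)" for y1 y2
    using Cons.prems(3) n by (auto intro!: lin_iter_sum simp: mlist_Suc_iff)
  moreover have "lin sC sA (\<lambda>y1. ?\<Phi> x y1 y2)" for x y2
    using n by (auto intro!: lin_iter_sum mlin_lin[OF mlin_iter_sum[OF m1]])
  \<comment> \<open>The inner sum is itself multilinear in \<open>d2\<close> and \<open>xs\<close>,
    which makes the outer sum linear in \<open>y2\<close>.\<close>
  moreover have "mlin sC sA m (\<lambda>d2 xs. iter_sum y1 xs (\<lambda>ys d1. \<phi> (x # ys) d1 d2))" for x y1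
    unfolding mlin_def using mlin_mlist[OF mlin_iter_sum[OF m1]] m2
    by (auto intro!: lin_iter_sum mlin_lin[OF m2])
  then have "lin sC sA (\<lambda>y2. ?\<Phi> x y1 y2)" for x y1
    using n by (auto intro!: mlin_lin[OF mlin_iter_sum])
  ultimately have "psi_sum c a (\<lambda>x y. delta_sum y (?\<Phi> x)) =
      delta_sum c (\<lambda>c1 c2. psi_sum c2 a (\<lambda>x y2. psi_sum c1 x (\<lambda>x' y1. ?\<Phi> x' y1 y2)))"
    by (rule psi_sum_comult)
  \<comment> \<open>The twist of \<open>c1\<close> past the first argument still stands outside the
    sum along \<open>as\<close>; exchanging the two restores the recursion of the inner iterated
    sum.\<close>
  then show ?case
    by (simp add: IH psi_iter_commute)
qed

end


text \<open>Positions are counted from \<open>0\<close>: the face with index \<open>i\<close> in the coboundary formula is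
  \<open>merge (i - 1)\<close>.\<close>

definition merge :: "nat \<Rightarrow> 'a::times list \<Rightarrow> 'a list" where
  "merge k as = take k as @ (as ! k * as ! Suc k) # drop (k + 2) as"

lemma merge_0_Cons [simp]: "merge 0 (a # b # as) = (a * b) # as"
  and merge_Suc_Cons [simp]: "merge (Suc k) (a # as) = a # merge k as"
  by (simp_all add: merge_def)

lemma merge_append_left: "Suc k < length xs \<Longrightarrow> merge k (xs @ ys) = merge k xs @ ys"
  by (simp add: merge_def nth_append)

lemma merge_append_right: "merge (length xs + k) (xs @ ys) = xs @ merge k ys"
  by (simp add: merge_def nth_append)

lemma length_merge: "Suc k < length xs \<Longrightarrow> length (merge k xs) = length xs - 1"
  by (simp add: merge_def)

lemma lin_compose: "lin t u h \<Longrightarrow> lin s t f \<Longrightarrow> lin s u (\<lambda>z. h (f z))"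
  by (simp add: lin_def)

lemma sum_lessThan_add:
  "(\<Sum>i<m + n. f i) = (\<Sum>i<m. f i) + (\<Sum>j<n. f (m + j))" for f :: "nat \<Rightarrow> 'a::comm_monoid_add"
  by (induction n) (simp_all add: add.assoc)

text \<open>Slots \<open>k\<close> and \<open>Suc k\<close> feed slot \<open>k\<close> of
  \<open>H\<close> through a product, which is linear in each factor; the other slots are only
  relocated.\<close>

lemma (in k_algebra) mlist_merge:
  "mlist sA n H \<Longrightarrow> k < n \<Longrightarrow> mlist sA (Suc n) (\<lambda>as. H (merge k as))"
proof (induction k arbitrary: n H)
  case 0
  then obtain n' where n: "n = Suc n'" by (cases n) auto
  have lin: "lin sA sA (\<lambda>a. H (a # bs))" if "length bs = n'" for bs
    using 0 n that by (simp add: mlist_Suc_iff)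
  have "lin sA sA (\<lambda>a. H ((a * b) # bs))" "lin sA sA (\<lambda>b. H ((a * b) # bs))"
    if "length bs = n'" for a b bs
    using lin_compose[OF lin[OF that] lin_mult_left[OF lin_id]]
      lin_compose[OF lin[OF that] lin_mult_right[OF lin_id]] by auto
  then show ?case
    using 0 n by (auto simp: mlist_Suc_iff length_Suc_conv)
next
  case (Suc k)
  then obtain n' where n: "n = Suc n'" by (cases n) auto
  have "mlist sA (Suc n') (\<lambda>as. H (a # merge k as))" for a
    using Suc n by (intro Suc.IH) (auto simp: mlist_Suc_iff)
  moreover have "lin sA sA (\<lambda>a. H (a # merge k as))" if "length as = Suc n'" for as
    using Suc.prems n that by (simp add: mlist_Suc_iff length_merge)
  ultimately show ?case
    using n by (subst mlist_Suc_iff) simp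
qed


section \<open>Cup product and coboundary of multilinear maps\<close>

context entwining_structure
begin

section \<open>Linearity of the sums in the summand\<close>

lemma delta_sum_add: "delta_sum c (\<lambda>x y. \<phi> x y + \<phi>' x y) = delta_sum c \<phi> + delta_sum c \<phi>'"
  by (simp add: delta_sum_def split_def A.sw_add)

lemma psi_sum_add: "psi_sum c a (\<lambda>x y. \<phi> x y + \<phi>' x y) = psi_sum c a \<phi> + psi_sum c a \<phi>'"
  by (simp add: psi_sum_def split_def A.sw_add)

lemma iter_sum_add: "iter_sum c as (\<lambda>x y. \<phi> x y + \<phi>' x y) = iter_sum c as \<phi> + iter_sum c as \<phi>'"
  by (induction as arbitrary: c \<phi> \<phi>') (simp_all add: psi_sum_add)

lemmas lin_scale_id = A.lin_scale_right[OF A.lin_id]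
lemmas scale_delta_sum = lin_apply_delta_sum[OF lin_scale_id]
lemmas scale_iter_sum = lin_apply_iter_sum[OF lin_scale_id]

lemma delta_sum_zero: "delta_sum c (\<lambda>x y. 0) = 0"
  using delta_sum_add[of c "\<lambda>x y. 0" "\<lambda>x y. 0"] by simp

lemma iter_sum_zero: "iter_sum c as (\<lambda>x y. 0) = 0"
  using iter_sum_add[of c as "\<lambda>x y. 0" "\<lambda>x y. 0"] by simp

lemma delta_sum_sum: "delta_sum c (\<lambda>x y. \<Sum>i\<in>S. \<phi> i x y) = (\<Sum>i\<in>S. delta_sum c (\<phi> i))"
  by (induction S rule: infinite_finite_induct) (simp_all add: delta_sum_zero delta_sum_add)

lemma iter_sum_sum: "iter_sum c as (\<lambda>x y. \<Sum>i\<in>S. \<phi> i x y) = (\<Sum>i\<in>S. iter_sum c as (\<phi> i))"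
  by (induction S rule: infinite_finite_induct) (simp_all add: iter_sum_zero iter_sum_add)

definition mcup :: "nat \<Rightarrow> ('c \<Rightarrow> 'a list \<Rightarrow> 'a) \<Rightarrow> ('c \<Rightarrow> 'a list \<Rightarrow> 'a) \<Rightarrow> 'c \<Rightarrow> 'a list \<Rightarrow> 'a" where
  "mcup m F G c as =
     delta_sum c (\<lambda>c1 c2. iter_sum c2 (take m as) (\<lambda>bs d. F c1 bs * G d (drop m as)))"

text \<open>The inner faces are counted from 0, whence the exponent \<open>Suc i\<close>, and the
  signs act as scalars; \<open>cobd_formula_eq\<close> matches this with
  \<open>cobd_formula\<close>.\<close>

definition mcobd :: "nat \<Rightarrow> ('c \<Rightarrow> 'a list \<Rightarrow> 'a) \<Rightarrow> 'c \<Rightarrow> 'a list \<Rightarrow> 'a" where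
  "mcobd n F c as =
     psi_sum c (hd as) (\<lambda>x y. x * F y (tl as))
     + (\<Sum>i<n. sA ((- 1) ^ Suc i) (F c (merge i as)))
     + sA ((- 1) ^ Suc n) (F c (butlast as) * last as)"

text \<open>In degree zero the cup product is the convolution product on Hom(C, A), and this is its
  unit.\<close>

definition munit :: "'c \<Rightarrow> 'a list \<Rightarrow> 'a" where
  "munit c as = sA (\<epsilon> c) 1"

section \<open>Multilinearity of the cup product, its unit and the coboundary\<close>

lemma mcup_append:
  "length xs = m \<Longrightarrow> mcup m F G c (xs @ ys) =
     delta_sum c (\<lambda>c1 c2. iter_sum c2 xs (\<lambda>bs d. F c1 bs * G d ys))"
  by (simp add: mcup_def)

lemma mlin_mult_right: "mlin sC sA m F \<Longrightarrow> mlin sC sA m (\<lambda>d bs. k * F d bs)"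
  by (auto simp: mlin_def mlist_def intro: A.lin_mult_left A.lin_mult_right)

lemma mlin_mult_separate:
  assumes "mlist sA m H" "lin sC sA h"
  shows "mlin sC sA m (\<lambda>d bs. H bs * h d)"
  using assms by (auto simp: mlin_def mlist_def intro: A.lin_mult_left A.lin_mult_right)

lemma mlin_cup_integrand:
  assumes "mlin sC sA m F" "mlin sC sA n G" "length ys = n"
  shows "mlin sC sA m (\<lambda>c2 xs. iter_sum c2 xs (\<lambda>bs d. F c1 bs * G d ys))"
  using assms by (intro mlin_iter_sum mlin_mult_separate mlin_mlist mlin_lin)

lemma lin_cup_integrand:
  assumes "mlin sC sA m F" "mlin sC sA n G" "length xs = m" "length ys = n"
  shows "lin sC sA (\<lambda>c2. iter_sum c2 xs (\<lambda>bs d. F c1 bs * G d ys))"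
    and "lin sC sA (\<lambda>c1. iter_sum c2 xs (\<lambda>bs d. F c1 bs * G d ys))"
  using assms(3,4)
  by (auto intro!: mlin_lin[OF mlin_cup_integrand[OF assms(1,2)]] lin_iter_sum A.lin_mult_left
      mlin_lin[OF assms(1)])

text \<open>The coalgebra argument enters through \<open>\<Delta>\<close>, the first
  \<open>m\<close> slots through the iterated sum and the last \<open>n\<close> slots directly
  through \<open>G\<close>.\<close>

lemma mlin_mcup:
  assumes F: "mlin sC sA m F" and G: "mlin sC sA n G"
  shows "mlin sC sA (m + n) (mcup m F G)"
  unfolding mlin_def
proof (intro conjI allI impI)
  fix as :: "'a list" assume "length as = m + n"
  then show "lin sC sA (\<lambda>c. mcup m F G c as)"
    unfolding mcup_def by (intro lin_delta_sum_arg lin_cup_integrand[OF F G]) auto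
next
  fix c
  show "mlist sA (m + n) (mcup m F G c)"
  proof (rule mlist_append)
    fix ys :: "'a list" assume ys: "length ys = n"
    show "mlist sA m (\<lambda>xs. mcup m F G c (xs @ ys))"
      unfolding mlist_def
    proof (intro allI impI)
      fix us vs :: "'a list" assume "length us + 1 + length vs = m"
      then show "lin sA sA (\<lambda>a. mcup m F G c ((us @ a # vs) @ ys))"
        using mlist_lin[OF mlin_mlist[OF mlin_cup_integrand[OF F G ys]]]
        by (subst mcup_append) (auto intro!: lin_delta_sum)
    qed
  next
    fix xs :: "'a list" assume "length xs = m"
    then show "mlist sA n (\<lambda>ys. mcup m F G c (xs @ ys))"
      using mlist_lin[OF mlin_mlist[OF G]]
      by (auto simp: mcup_append mlist_def intro!: lin_delta_sum lin_iter_sum A.lin_mult_right)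
  qed
qed

lemma mlin_munit: "mlin sC sA 0 munit"
proof -
  have "lin sC (*) \<epsilon>"
    using C.counit_linear by (simp add: klinear_def lin_def type_space_def)
  then show ?thesis by (simp add: mlin_def munit_def A.lin_scale_left)
qed

lemma lin_first_face:
  assumes F: "mlin sC sA n F" and "length as = n"
  shows "lin sA sA (\<lambda>x. x * F y as)" and "lin sC sA (\<lambda>y. x * F y as)"
  using assms by (auto intro!: A.lin_mult_left A.lin_mult_right A.lin_id mlin_lin)

lemma mlin_mcobd:
  assumes F: "mlin sC sA n F"
  shows "mlin sC sA (n + 1) (mcobd n F)"
  unfolding mlin_def
proof (intro conjI allI impI)
  fix as :: "'a list" assume as: "length as = n + 1"
  then show "lin sC sA (\<lambda>c. mcobd n F c as)"
    unfolding mcobd_def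
    by (intro A.lin_plus A.lin_sum A.lin_scale_right A.lin_mult_left mlin_lin[OF F]
        lin_psi_sum_coalg lin_first_face[OF F]) (auto simp: length_merge)
next
  fix c
  have face0: "mlist sA (Suc n) (\<lambda>as. psi_sum c (hd as) (\<lambda>x y. x * F y (tl as)))"
    using F by (auto simp: mlist_Suc_iff intro!: lin_psi_sum_alg lin_first_face)
      (auto simp: mlist_def intro!: lin_psi_sum A.lin_mult_right mlist_lin[OF mlin_mlist[OF F]])
  have face: "mlist sA (Suc n) (\<lambda>as. F c (merge i as))" if "i < n" for i
    using A.mlist_merge[OF mlin_mlist[OF F] that] .
  \<comment> \<open>If the varying entry is the last one, the product is linear in its right factor;
    otherwise that factor is fixed and \<open>F\<close> carries the linearity.\<close>
  have last: "lin sA sA (\<lambda>a. F c (butlast (us @ a # vs)) * last (us @ a # vs))"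
    if "length us + 1 + length vs = Suc n" for us vs
  proof (cases vs rule: rev_cases)
    case Nil
    then show ?thesis by (simp add: butlast_append A.lin_mult_right A.lin_id)
  next
    case (snoc ws w)
    then show ?thesis
      using that mlist_lin[OF mlin_mlist[OF F], of us ws]
      by (simp add: butlast_append A.lin_mult_left)
  qed
  show "mlist sA (n + 1) (mcobd n F c)"
    unfolding mlist_def mcobd_def
    by (intro allI impI A.lin_plus A.lin_sum A.lin_scale_right mlist_lin[OF face0]
        mlist_lin[OF face] last) auto
qed

section \<open>Unit laws\<close>

text \<open>The counit law of \<open>\<psi>\<close>, used once for each argument from the last to
  the first, removes all the twists.\<close>

lemma iter_sum_counit:
  "mlist sA n H \<Longrightarrow> length as = n \<Longrightarrow> iter_sum c as (\<lambda>bs d. sA (\<epsilon> d) (H bs)) = sA (\<epsilon> c) (H as)"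
proof (induction as arbitrary: n H c)
  case (Cons a as)
  then obtain m where n: "n = Suc m" "length as = m" by auto
  then have "iter_sum y as (\<lambda>bs d. sA (\<epsilon> d) (H (x # bs))) = sA (\<epsilon> y) (H (x # as))" for x y
    using Cons.prems by (intro Cons.IH[of m]) (auto simp: mlist_Suc_iff)
  then show ?case
    using Cons.prems n by (simp add: mlist_Suc_iff psi_sum_counit[of "\<lambda>x. H (x # as)"])
qed simp

lemma mcup_munit_left:
  assumes "mlin sC sA n F" "length as = n"
  shows "mcup 0 munit F c as = F c as"
  using delta_sum_counit(1)[OF mlin_lin[OF assms]]
  by (simp add: mcup_def munit_def A.scale_mult_left)

lemma mcup_munit_right:
  assumes "mlin sC sA n F" "length as = n"
  shows "mcup n F munit c as = F c as"
  using delta_sum_counit(2)[OF mlin_lin[OF assms]] assms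
  by (simp add: mcup_def munit_def A.scale_mult_right iter_sum_counit[OF mlin_mlist])

section \<open>Associativity of the cup product\<close>

lemma mcup_assoc:
  assumes F: "mlin sC sA m F" and G: "mlin sC sA n G" and H: "mlin sC sA p H"
    and as: "length as = m + n + p"
  shows "mcup (m + n) (mcup m F G) H c as = mcup m F (mcup n G H) c as"
proof -
  obtain us vs ws where as_eq: "as = us @ vs @ ws"
    and len: "length us = m" "length vs = n" "length ws = p"
    using as that[of "take m as" "take n (drop m as)" "drop n (drop m as)"]
    unfolding append_take_drop_id by simp
  \<comment> \<open>In \<open>?\<Phi>\<close> the leg \<open>u\<close> is taken by \<open>G\<close>,
    and \<open>v\<close> is carried past \<open>vs\<close> on its way to \<open>H\<close>.
    \<open>?\<Psi>\<close> first carries both legs past \<open>us\<close>.\<close>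
  let ?\<Phi> = "\<lambda>x xs u v. iter_sum v vs (\<lambda>zs e. F x xs * G u zs * H e ws)"
  let ?\<Psi> = "\<lambda>x y1 y2. iter_sum y2 us (\<lambda>xs d. iter_sum y1 xs (\<lambda>ys u. ?\<Phi> x ys u d))"
  have \<Phi>: "mlin sC sA m (\<lambda>u xs. ?\<Phi> x xs u v)" for x v
    unfolding mlin_def mlist_def using len
    by (auto intro!: lin_iter_sum A.lin_mult_left A.lin_mult_right mlin_lin[OF G]
        mlist_lin[OF mlin_mlist[OF F]])
  have \<Phi>': "mlin sC sA m (\<lambda>v xs. ?\<Phi> x xs u v)" for x u
    unfolding mlin_def mlist_def using len
    by (auto intro!: lin_iter_sum A.lin_mult_left A.lin_mult_right mlist_lin[OF mlin_mlist[OF F]]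
        mlin_lin[OF mlin_iter_sum] mlin_mult_separate mlin_lin[OF H] mlin_mlist[OF mlin_mult_right[OF G]])
  have "mcup (m + n) (mcup m F G) H c as = delta_sum c (\<lambda>c1 c2. iter_sum c2 us (\<lambda>xs d.
      iter_sum d vs (\<lambda>zs e. mcup m F G c1 (xs @ zs) * H e ws)))"
    using len by (simp add: mcup_def[of "m + n"] as_eq iter_sum_append)
  also have "\<dots> = delta_sum c (\<lambda>c1 c2. iter_sum c2 us (\<lambda>xs d.
      iter_sum d vs (\<lambda>zs e. delta_sum c1 (\<lambda>x y. iter_sum y xs (\<lambda>ys u. F x ys * G u zs * H e ws)))))"
    using len by (auto intro!: arg_cong[of _ _ "delta_sum c"] ext iter_sum_cong
        simp: mcup_append mult_delta_sum mult_iter_sum)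
  \<comment> \<open>The coproduct of \<open>c1\<close> is independent of the twists of
    \<open>c2\<close>, so its sum moves outwards; then the sums along \<open>xs\<close> and
    \<open>vs\<close> are exchanged.\<close>
  also have "\<dots> = delta_sum c (\<lambda>c1 c2. delta_sum c1 (\<lambda>x y. ?\<Psi> x y c2))"
    by (simp add: delta_iter_commute[symmetric] iter_iter_commute[of _ vs])
  \<comment> \<open>After coassociativity the legs meant for \<open>G\<close> and \<open>H\<close>
    come from one coproduct, and \<open>iter_sum_comult\<close> can take it after the twist past
    \<open>us\<close>.\<close>
  also have "\<dots> = delta_sum c (\<lambda>x y. delta_sum y (?\<Psi> x))"
  proof (rule delta_sum_coassoc)
    show "lin sC sA (\<lambda>x. ?\<Psi> x y z)" for y z
      using len by (auto intro!: lin_iter_sum A.lin_mult_left mlin_lin[OF F])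
    show "lin sC sA (\<lambda>y. ?\<Psi> x y z)" for x z
      using len by (auto intro!: lin_iter_sum mlin_lin[OF mlin_iter_sum[OF \<Phi>]])
    have "mlin sC sA m (\<lambda>d xs. iter_sum y xs (\<lambda>ys u. ?\<Phi> x ys u d))" for x y
      unfolding mlin_def using mlin_mlist[OF mlin_iter_sum[OF \<Phi>]]
      by (auto intro!: lin_iter_sum mlin_lin[OF \<Phi>'])
    then show "lin sC sA (?\<Psi> x y)" for x y
      using len by (auto intro!: mlin_lin[OF mlin_iter_sum])
  qed
  also have "\<dots> = delta_sum c (\<lambda>x y. iter_sum y us (\<lambda>xs d. delta_sum d (?\<Phi> x xs)))"
    using len by (subst iter_sum_comult[of m])
      (auto intro!: mlin_lin[OF \<Phi>] mlin_lin[OF \<Phi>'] mlin_mlist[OF \<Phi>])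
  also have "\<dots> = mcup m F (mcup n G H) c as"
    using len by (simp add: as_eq mcup_append mult_delta_sum mult_iter_sum mult.assoc)
  finally show ?thesis .
qed

section \<open>The Leibniz rule for multilinear maps\<close>

text \<open>Twisting past a product is twisting past its factors in turn and multiplying the
  results, so merging before the twists agrees with merging after them.\<close>

lemma iter_sum_merge:
  "mlin sC sA n (\<lambda>d bs. h bs d) \<Longrightarrow> length as = Suc n \<Longrightarrow> k < n \<Longrightarrow>
    iter_sum c (merge k as) h = iter_sum c as (\<lambda>bs. h (merge k bs))"
proof (induction k arbitrary: n h as c)
  case 0
  then obtain m a b cs where n: "n = Suc m" and as: "as = a # b # cs" "length cs = m"
    by (auto simp: length_Suc_conv gr0_conv_Suc)
  have "lin sA sA (\<lambda>x. iter_sum y cs (\<lambda>bs. h (x # bs)))" for y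
    using 0 n as by (auto intro!: lin_iter_sum mlin_Suc_head[of _ _ m "\<lambda>d bs. h bs d"])
  moreover have "lin sC sA (\<lambda>y. iter_sum y cs (\<lambda>bs. h (x # bs)))" for x
    using 0 n as by (auto intro!: mlin_lin[OF mlin_iter_sum] mlin_Suc_tail)
  ultimately show ?case
    by (simp add: as psi_sum_mult)
next
  case (Suc k)
  then obtain m a cs where n: "n = Suc m" and as: "as = a # cs" "length cs = Suc m"
    by (cases n) (auto simp: length_Suc_conv)
  have "iter_sum y (merge k cs) (\<lambda>bs. h (x # bs)) =
      iter_sum y cs (\<lambda>bs. h (x # merge k bs))" for x y
    using Suc n as by (intro Suc.IH[of m]) (auto intro: mlin_Suc_tail)
  then show ?case by (simp add: as)
qed

text \<open>Compatibility of \<open>\<psi>\<close> with \<open>\<Delta>\<close> carries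
  \<open>a\<close> past the second leg, which lengthens the iterated sum by one argument, and then
  past the first leg, which is the first face of the coboundary of \<open>F\<close>.\<close>

lemma psi_sum_mcup:
  assumes F: "mlin sC sA m F" and G: "mlin sC sA n G" and len: "length as = m" "length ys = n"
  shows "psi_sum c a (\<lambda>x y. x * mcup m F G y (as @ ys)) =
    delta_sum c (\<lambda>c1 c2. iter_sum c2 (a # as)
      (\<lambda>bs d. psi_sum c1 (hd bs) (\<lambda>x y. x * F y (tl bs)) * G d ys))"
proof -
  let ?\<Phi> = "\<lambda>x y1 y2. x * iter_sum y2 as (\<lambda>bs d. F y1 bs * G d ys)"
  have "psi_sum c a (\<lambda>x y. delta_sum y (?\<Phi> x)) =
      delta_sum c (\<lambda>c1 c2. psi_sum c2 a (\<lambda>x y2. psi_sum c1 x (\<lambda>x' y1. ?\<Phi> x' y1 y2)))"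
    using len by (intro psi_sum_comult A.lin_mult_left A.lin_mult_right A.lin_id
        lin_cup_integrand[OF F G])
  then show ?thesis
    using len by (simp add: mcup_append mult_delta_sum mult_psi_sum mult_iter_sum psi_iter_commute
        mult.assoc)
qed

lemma mcobd_mcup:
  assumes F: "mlin sC sA m F" and G: "mlin sC sA n G" and as: "length as = m + n + 1"
  shows "mcobd (m + n) (mcup m F G) c as =
    mcup (m + 1) (mcobd m F) G c as + sA ((- 1) ^ m) (mcup m F (mcobd n G) c as)"
proof -
  \<comment> \<open>The entry \<open>b\<close> is the last argument of the coboundary of
    \<open>F\<close> in one product and the first argument of the coboundary of \<open>G\<close> in
    the other.\<close>
  obtain xs b ys where as_eq: "as = xs @ b # ys" and len: "length xs = m" "length ys = n"
    using as that[of "take m as" "as ! m" "drop (Suc m) as"]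
    by (simp add: id_take_nth_drop[symmetric])
  let ?T = "\<lambda>h. delta_sum c (\<lambda>c1 c2. iter_sum c2 (xs @ [b]) (\<lambda>bs d. h c1 bs * G d ys))"
  \<comment> \<open>\<open>T0\<close>, \<open>M i\<close> and \<open>Z\<close> are the first, inner
    and last faces of the cup product. \<open>L\<close> occurs in both products on the right, with
    opposite signs.\<close>
  define T0 where "T0 = ?T (\<lambda>c bs. psi_sum c (hd bs) (\<lambda>x y. x * F y (tl bs)))"
  define M where "M = (\<lambda>i. mcup m F G c (merge i as))"
  define L where "L = ?T (\<lambda>c bs. F c (butlast bs) * last bs)"
  define Z where "Z = mcup m F G c (butlast as) * last as"
  have T0: "psi_sum c (hd as) (\<lambda>x y. x * mcup m F G y (tl as)) = T0"
  proof -
    \<comment> \<open>The head of \<open>as\<close> is \<open>b\<close> itself when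
      \<open>xs\<close> is empty, so the list is recut from the left.\<close>
    obtain a zs where a: "xs @ [b] = a # zs" by (cases "xs @ [b]") auto
    then have "as = a # zs @ ys" "length zs = m"
      using as_eq len by (auto simp: Cons_eq_append_conv append_eq_Cons_conv)
    then show ?thesis
      using psi_sum_mcup[OF F G, of zs ys c a] len by (simp add: T0_def a)
  qed
  \<comment> \<open>For \<open>i < m\<close> the merged pair lies within \<open>xs @ [b]\<close>, so
    merging takes place inside the arguments of the first factor.\<close>
  have M: "?T (\<lambda>c bs. F c (merge i bs)) = M i" if "i < m" for i
  proof -
    have "merge i as = merge i (xs @ [b]) @ ys"
      using that len merge_append_left[of i "xs @ [b]" ys] by (simp add: as_eq)
    moreover have "length (merge i (xs @ [b])) = m"
      using that len by (simp add: length_merge)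
    moreover have "iter_sum c2 (merge i (xs @ [b])) (\<lambda>bs d. F c1 bs * G d ys) =
        iter_sum c2 (xs @ [b]) (\<lambda>bs d. F c1 (merge i bs) * G d ys)" for c1 c2
      using that len
      by (intro iter_sum_merge[of m] mlin_mult_separate mlin_mlist[OF F] mlin_lin[OF G]) auto
    ultimately show ?thesis by (simp add: M_def mcup_append)
  qed
  have M': "mcup m F (\<lambda>c bs. G c (merge j bs)) c as = M (m + j)" for j
    using merge_append_right[of xs j "b # ys"] len
    by (simp add: M_def as_eq mcup_append)
  \<comment> \<open>The first face of \<open>G\<close> twists past \<open>b\<close>, which extends
    the sum along \<open>xs\<close> by this one entry; the twisted \<open>b\<close> then multiplies
    \<open>F\<close> from the right.\<close>
  have L: "mcup m F (\<lambda>c bs. psi_sum c (hd bs) (\<lambda>x y. x * G y (tl bs))) c as = L"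
    using len by (simp add: L_def as_eq mcup_append iter_sum_append mult_psi_sum mult.assoc)
  have Z: "mcup m F (\<lambda>c bs. G c (butlast bs) * last bs) c as = Z"
    using len by (simp add: Z_def as_eq butlast_append mcup_append mult_delta_sum mult_iter_sum mult.assoc
        del: butlast.simps last.simps)
  have "mcup (m + 1) (mcobd m F) G c as = ?T (mcobd m F)"
    using mcup_append[of "xs @ [b]" "m + 1"] len by (simp add: as_eq)
  also have "\<dots> = T0 + (\<Sum>i<m. sA ((- 1) ^ Suc i) (M i)) + sA ((- 1) ^ Suc m) L"
    by (simp add: mcobd_def distrib_right sum_distrib_right A.scale_mult_left delta_sum_add iter_sum_add
        delta_sum_sum iter_sum_sum scale_delta_sum[symmetric] scale_iter_sum[symmetric] T0_def M L_def
        del: power_Suc)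
  finally have 1: "mcup (m + 1) (mcobd m F) G c as =
      T0 + (\<Sum>i<m. sA ((- 1) ^ Suc i) (M i)) + sA ((- 1) ^ Suc m) L" .
  have "mcup m F (mcobd n G) c as = L + (\<Sum>j<n. sA ((- 1) ^ Suc j) (M (m + j))) + sA ((- 1) ^ Suc n) Z"
    unfolding L[symmetric] M'[symmetric] Z[symmetric]
    by (simp add: mcup_def mcobd_def distrib_left sum_distrib_left A.scale_mult_right delta_sum_add iter_sum_add
        delta_sum_sum iter_sum_sum scale_delta_sum[symmetric] scale_iter_sum[symmetric]
        del: power_Suc)
  \<comment> \<open>The two multiples of \<open>L\<close> cancel, and the faces with
    \<open>i < m\<close> and those at \<open>m + j\<close> together are all inner faces.\<close>
  then show ?thesis
    unfolding 1
    by (simp add: mcobd_def T0 M_def Z_def[symmetric] sum_lessThan_add A.scale_right_distrib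
        A.scale_right_diff_distrib A.scale_sum_right power_add sum_negf)
qed

end


section \<open>Cochains as multilinear maps\<close>

lemma sum_fun_apply: "(\<Sum>i\<in>S. f i) x = (\<Sum>i\<in>S. f i x)"
  by (induction S rule: infinite_finite_induct) simp_all

lemma sum_triple_reindex:
  fixes f :: "nat \<Rightarrow> nat \<Rightarrow> nat \<Rightarrow> 'a::comm_monoid_add"
  shows "(\<Sum>j\<le>n. \<Sum>i\<le>j. f i (j - i) (n - j)) = (\<Sum>i\<le>n. \<Sum>j\<le>n - i. f i j (n - i - j))"
proof -
  \<comment> \<open>The upper bound is separated from \<open>n\<close> so that the summand stays
    unchanged in the induction.\<close>
  have "(\<Sum>j\<le>k. \<Sum>i\<le>j. f i (j - i) (n - j)) = (\<Sum>i\<le>k. \<Sum>j\<le>k - i. f i j (n - i - j))" for k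
    by (induction k) (simp_all add: Suc_diff_le sum.distrib add.assoc)
  then show ?thesis .
qed

context entwining_structure
begin

abbreviation Coch :: "nat \<Rightarrow> ('k, 'a, 'c) cochain set" where
  "Coch \<equiv> cochains sA sC"

abbreviation Cup where "Cup \<equiv> cup sA sC \<Delta> \<psi>"

abbreviation Cobd where "Cobd \<equiv> cobd sA sC \<psi>"

text \<open>Restriction to pure tensors; together with \<open>lin_ext\<close> it translates between
  cochains and multilinear maps.\<close>

definition ev :: "nat \<Rightarrow> ('k, 'a, 'c) cochain \<Rightarrow> 'c \<Rightarrow> 'a list \<Rightarrow> 'a" where
  "ev n f c as = f (puren sC sA n c as)"

lemma ev_add: "ev n (f + g) = (\<lambda>c as. ev n f c as + ev n g c as)"
  and ev_scale: "ev n (cochain_scale sA r f) = (\<lambda>c as. sA r (ev n f c as))"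
  by (simp_all add: ev_def cochain_scale_def fun_eq_iff)

lemma puren_carrier: "length as = n \<Longrightarrow> puren sC sA n c as \<in> vcar (tensorn sC sA n)"
  by (auto simp: tensorn_def quotient_space_def)

lemma slot_rels_relsn_coalg: "length as = n \<Longrightarrow> slot_rels sC (\<lambda>c. (c, as)) \<subseteq> relsn sC sA n"
  unfolding relsn_def by (rule order_trans[OF _ free.span_superset]) blast

lemma slot_rels_relsn_alg:
  "length xs + 1 + length ys = n \<Longrightarrow> slot_rels sA (\<lambda>a. (c, xs @ a # ys)) \<subseteq> relsn sC sA n"
  unfolding relsn_def by (rule order_trans[OF _ free.span_superset]) blast

lemma lin_slot:
  assumes f: "f \<in> Coch n" and "slot_rels s e \<subseteq> relsn sC sA n"
    and e: "\<And>v. coset (relsn sC sA n) (gen (e v)) \<in> vcar (tensorn sC sA n)"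
  shows "lin s sA (\<lambda>v. f (coset (relsn sC sA n) (gen (e v))))"
proof (rule linI)
  have f: "klinear (tensorn sC sA n) (type_space sA) f"
    using f by (simp add: cochains_def khom_def)
  show "f (coset (relsn sC sA n) (gen (e (v + w)))) =
      f (coset (relsn sC sA n) (gen (e v))) + f (coset (relsn sC sA n) (gen (e w)))" for v w
    using f e unfolding coset_slot_add[OF subspace_relsn assms(2), where G = "{(c, as). length as = n}"]
    by (simp add: klinear_def type_space_def tensorn_def)
  show "f (coset (relsn sC sA n) (gen (e (s r v)))) = sA r (f (coset (relsn sC sA n) (gen (e v))))"
    for r v
    using f e unfolding coset_slot_scale[OF subspace_relsn assms(2), where G = "{(c, as). length as = n}"]
    by (simp add: klinear_def type_space_def tensorn_def)
qed

lemma mlin_ev: "f \<in> Coch n \<Longrightarrow> mlin sC sA n (ev n f)"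
  unfolding mlin_def mlist_def ev_def
  by (auto intro!: lin_slot slot_rels_relsn_coalg slot_rels_relsn_alg puren_carrier)

lemma lext_relsn:
  assumes "mlin sC sA n F" and "p \<in> relsn sC sA n"
  shows "lext sA (\<lambda>(c, as). F c as) p = 0"
  using assms(2) unfolding relsn_def
proof (rule A.lext_span_zero[rotated])
  fix b
  assume "b \<in> (\<Union>as\<in>{as. length as = n}. slot_rels sC (\<lambda>c. (c, as))) \<union>
    (\<Union>c. \<Union>(xs, ys)\<in>{(xs, ys). length xs + 1 + length ys = n}. slot_rels sA (\<lambda>a. (c, xs @ a # ys)))"
  then consider as where "length as = n" "b \<in> slot_rels sC (\<lambda>c. (c, as))"
    | c xs ys where "length xs + 1 + length ys = n" "b \<in> slot_rels sA (\<lambda>a. (c, xs @ a # ys))"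
    by auto
  then show "lext sA (\<lambda>(c, as). F c as) b = 0"
  proof cases
    case 1
    then show ?thesis
      using mlin_lin[OF assms(1)] by (intro A.lext_slot_rels[OF _ 1(2)]) simp
  next
    case 2
    then show ?thesis
      using mlist_lin[OF mlin_mlist[OF assms(1)]] by (intro A.lext_slot_rels[OF _ 2(2)]) simp
  qed
qed

lemma lin_ext_cochain:
  assumes "mlin sC sA n F"
  shows "lin_ext sA sC n F \<in> Coch n"
  using klinear_sw[OF subspace_relsn A.vector_space_axioms lext_relsn[OF assms]]
  by (auto simp: cochains_def khom_def lin_ext_def tensorn_def)

lemma lin_ext_puren:
  assumes "mlin sC sA n F" "length as = n"
  shows "lin_ext sA sC n F (puren sC sA n c as) = F c as"
  using A.sw_coset[OF subspace_relsn lext_relsn[OF assms(1)]] assms(2)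
  by (simp add: lin_ext_def puren_carrier)

text \<open>Pure tensors span the tensor product, and off the carrier both sides are 0 by the
  normalisation in \<open>khom\<close>.\<close>

lemma cochain_eqI:
  assumes f: "f \<in> Coch n" and g: "g \<in> Coch n"
    and eq: "\<And>c as. length as = n \<Longrightarrow> ev n f c as = ev n g c as"
  shows "f = g"
proof
  fix X
  have kl: "klinear (tensorn sC sA n) (type_space sA) f" "klinear (tensorn sC sA n) (type_space sA) g"
    using f g by (simp_all add: cochains_def khom_def)
  show "f X = g X"
  proof (cases "X \<in> vcar (tensorn sC sA n)")
    case True
    then obtain p where X: "X = coset (relsn sC sA n) p"
      and p: "Poly_Mapping.keys p \<subseteq> {(c, as). length as = n}"
      by (auto simp: tensorn_def quotient_space_def)
    have "lext sA (\<lambda>x. f (coset (relsn sC sA n) (gen x))) p =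
        lext sA (\<lambda>x. g (coset (relsn sC sA n) (gen x))) p"
      unfolding lext_def using p eq by (intro sum.cong) (auto simp: ev_def)
    then show ?thesis
      using kl p unfolding X tensorn_def
      by (simp add: klinear_lext[OF subspace_relsn A.vector_space_axioms])
  next
    case False
    then show ?thesis using f g by (simp add: cochains_def khom_def)
  qed
qed

lemma cup_formula_eq: "cup_formula sA sC \<Delta> \<psi> m n f g = mcup m (ev m f) (ev n g)"
  by (intro ext) (simp add: cup_formula_def mcup_def delta_sum_def ev_def)

lemma cobd_formula_eq: "cobd_formula sA sC \<psi> n f = mcobd n (ev n f)"
  by (intro ext) (simp add: cobd_formula_def mcobd_def psi_sum_def ev_def merge_def
      sum.atLeast1_atMost_eq A.minus_one_power_mult del: power_Suc)

lemma Cup_cochain: "f \<in> Coch m \<Longrightarrow> g \<in> Coch n \<Longrightarrow> Cup m n f g \<in> Coch (m + n)"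
  and Cup_puren: "f \<in> Coch m \<Longrightarrow> g \<in> Coch n \<Longrightarrow> length as = m + n \<Longrightarrow>
    Cup m n f g (puren sC sA (m + n) c as) = mcup m (ev m f) (ev n g) c as"
  by (simp_all add: cup_def cup_formula_eq lin_ext_cochain lin_ext_puren mlin_mcup mlin_ev)

lemma Cobd_cochain: "f \<in> Coch n \<Longrightarrow> Cobd n f \<in> Coch (n + 1)"
  and Cobd_puren: "f \<in> Coch n \<Longrightarrow> length as = n + 1 \<Longrightarrow>
    Cobd n f (puren sC sA (n + 1) c as) = mcobd n (ev n f) c as"
  unfolding cobd_def cobd_formula_eq
  by (intro lin_ext_cochain lin_ext_puren mlin_mcobd mlin_ev; assumption)+

text \<open>The degree is given up to an equation so that \<open>m + n + 1\<close> and
  \<open>m + 1 + n\<close> can be matched.\<close>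

lemma ev_Cup:
  assumes "f \<in> Coch m" "g \<in> Coch n" "k = m + n" "length as = k"
  shows "ev k (Cup m n f g) c as = mcup m (ev m f) (ev n g) c as"
  using assms by (simp add: ev_def[of "m + n"] Cup_puren)

lemma ev_Cobd:
  assumes "f \<in> Coch n" "k = n + 1" "length as = k"
  shows "ev k (Cobd n f) c as = mcobd n (ev n f) c as"
  using Cobd_puren[OF assms(1), of as c] assms by (simp add: ev_def)

lemma Coch_add: "f \<in> Coch n \<Longrightarrow> g \<in> Coch n \<Longrightarrow> f + g \<in> Coch n"
  and Coch_scale: "f \<in> Coch n \<Longrightarrow> cochain_scale sA r f \<in> Coch n"
  and Coch_zero: "0 \<in> Coch n"
  by (simp_all add: cochains_def khom_def klinear_def type_space_def cochain_scale_def
      A.scale_right_distrib mult.commute)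

lemma Coch_sum: "(\<And>i. i \<in> S \<Longrightarrow> f i \<in> Coch n) \<Longrightarrow> (\<Sum>i\<in>S. f i) \<in> Coch n"
  by (induction S rule: infinite_finite_induct) (auto intro: Coch_zero Coch_add)

text \<open>The values of a cup product or coboundary are known from their formulas on lists of the
  right length; nested operations are rewritten on those lists.\<close>

lemma mcup_cong:
  assumes "\<And>c bs. length bs = m \<Longrightarrow> F c bs = F' c bs" "\<And>c bs. length bs = n \<Longrightarrow> G c bs = G' c bs"
    and "length as = m + n"
  shows "mcup m F G c as = mcup m F' G' c as"
  unfolding mcup_def using assms
  by (intro arg_cong[of _ _ "delta_sum c"] ext iter_sum_cong) auto

lemma mcobd_cong:
  assumes "\<And>c bs. length bs = n \<Longrightarrow> F c bs = F' c bs" "length as = n + 1"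
  shows "mcobd n F c as = mcobd n F' c as"
  unfolding mcobd_def using assms by (simp add: length_merge)

lemma mcup_linear:
  "mcup m (\<lambda>c as. F c as + F' c as) G c as = mcup m F G c as + mcup m F' G c as"
  "mcup m F (\<lambda>c as. G c as + G' c as) c as = mcup m F G c as + mcup m F G' c as"
  "mcup m (\<lambda>c as. sA r (F c as)) G c as = sA r (mcup m F G c as)"
  "mcup m F (\<lambda>c as. sA r (G c as)) c as = sA r (mcup m F G c as)"
  by (simp_all add: mcup_def distrib_left distrib_right delta_sum_add iter_sum_add
      A.scale_mult_left A.scale_mult_right scale_delta_sum scale_iter_sum)

lemma mcobd_linear:
  "mcobd n (\<lambda>c as. F c as + F' c as) c as = mcobd n F c as + mcobd n F' c as"
  "mcobd n (\<lambda>c as. sA r (F c as)) c as = sA r (mcobd n F c as)"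
  by (simp_all add: mcobd_def distrib_left distrib_right psi_sum_add sum.distrib
      A.scale_mult_left A.scale_mult_right A.scale_right_distrib A.scale_sum_right
      lin_apply_psi_sum[OF lin_scale_id] mult.commute del: power_Suc)

context
  fixes m n f g
  assumes f: "f \<in> Coch m" and g: "g \<in> Coch n"
begin

lemma Cup_add_left: "f' \<in> Coch m \<Longrightarrow> Cup m n (f + f') g = Cup m n f g + Cup m n f' g"
  using f g by (intro cochain_eqI[of _ "m + n"])
    (simp_all add: Cup_cochain Coch_add ev_add ev_Cup mcup_linear)

lemma Cup_add_right: "g' \<in> Coch n \<Longrightarrow> Cup m n f (g + g') = Cup m n f g + Cup m n f g'"
  using f g by (intro cochain_eqI[of _ "m + n"])
    (simp_all add: Cup_cochain Coch_add ev_add ev_Cup mcup_linear)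

lemma Cup_scale_left: "Cup m n (cochain_scale sA r f) g = cochain_scale sA r (Cup m n f g)"
  using f g by (intro cochain_eqI[of _ "m + n"])
    (simp_all add: Cup_cochain Coch_scale ev_scale ev_Cup mcup_linear)

lemma Cup_scale_right: "Cup m n f (cochain_scale sA r g) = cochain_scale sA r (Cup m n f g)"
  using f g by (intro cochain_eqI[of _ "m + n"])
    (simp_all add: Cup_cochain Coch_scale ev_scale ev_Cup mcup_linear)

lemma Cup_assoc:
  assumes "h \<in> Coch p"
  shows "Cup (m + n) p (Cup m n f g) h = Cup m (n + p) f (Cup n p g h)"
proof (rule cochain_eqI[of _ "m + n + p"])
  show "Cup (m + n) p (Cup m n f g) h \<in> Coch (m + n + p)"
    using f g assms by (intro Cup_cochain)
  show "Cup m (n + p) f (Cup n p g h) \<in> Coch (m + n + p)"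
    using Cup_cochain[OF f Cup_cochain[OF g assms]] by (simp add: add.assoc)
  fix c and as :: "'a list"
  assume len: "length as = m + n + p"
  have "ev (m + n + p) (Cup (m + n) p (Cup m n f g) h) c as =
      mcup (m + n) (ev (m + n) (Cup m n f g)) (ev p h) c as"
    using len by (intro ev_Cup Cup_cochain f g assms) simp_all
  also have "\<dots> = mcup (m + n) (mcup m (ev m f) (ev n g)) (ev p h) c as"
    using len by (intro mcup_cong ev_Cup f g) simp_all
  also have "\<dots> = mcup m (ev m f) (mcup n (ev n g) (ev p h)) c as"
    by (rule mcup_assoc[OF mlin_ev[OF f] mlin_ev[OF g] mlin_ev[OF assms] len])
  also have "\<dots> = mcup m (ev m f) (ev (n + p) (Cup n p g h)) c as"
    using len by (intro mcup_cong ev_Cup[symmetric] g assms) simp_all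
  also have "\<dots> = ev (m + n + p) (Cup m (n + p) f (Cup n p g h)) c as"
    using len by (intro ev_Cup[symmetric] Cup_cochain f g assms) simp_all
  finally show "ev (m + n + p) (Cup (m + n) p (Cup m n f g) h) c as =
      ev (m + n + p) (Cup m (n + p) f (Cup n p g h)) c as" .
qed

lemma Cobd_Cup:
  "Cobd (m + n) (Cup m n f g) =
    Cup (m + 1) n (Cobd m f) g + cochain_scale sA ((- 1) ^ m) (Cup m (n + 1) f (Cobd n g))"
  (is "?L = ?R1 + cochain_scale sA _ ?R2")
proof (rule cochain_eqI[of _ "m + n + 1"])
  show "?L \<in> Coch (m + n + 1)"
    using f g by (intro Cobd_cochain Cup_cochain)
  have "?R1 \<in> Coch (m + 1 + n)" "?R2 \<in> Coch (m + (n + 1))"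
    by (simp_all only: Cobd_cochain Cup_cochain f g)
  then show "?R1 + cochain_scale sA ((- 1) ^ m) ?R2 \<in> Coch (m + n + 1)"
    by (intro Coch_add Coch_scale) (simp_all add: ac_simps)
  fix c and as :: "'a list"
  assume len: "length as = m + n + 1"
  have "ev (m + n + 1) ?L c as = mcobd (m + n) (ev (m + n) (Cup m n f g)) c as"
    using len by (intro ev_Cobd Cup_cochain f g) simp_all
  also have "\<dots> = mcobd (m + n) (mcup m (ev m f) (ev n g)) c as"
    using len by (intro mcobd_cong ev_Cup f g) simp_all
  finally have "ev (m + n + 1) ?L c as = mcobd (m + n) (mcup m (ev m f) (ev n g)) c as" .
  moreover have "ev (m + n + 1) ?R1 c as = mcup (m + 1) (ev (m + 1) (Cobd m f)) (ev n g) c as"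
    using len by (intro ev_Cup Cobd_cochain f g) simp_all
  moreover have "\<dots> = mcup (m + 1) (mcobd m (ev m f)) (ev n g) c as"
    using len by (intro mcup_cong ev_Cobd f) simp_all
  moreover have "ev (m + n + 1) ?R2 c as = mcup m (ev m f) (ev (n + 1) (Cobd n g)) c as"
    using len by (intro ev_Cup Cobd_cochain f g) simp_all
  moreover have "\<dots> = mcup m (ev m f) (mcobd n (ev n g)) c as"
    using len by (intro mcup_cong ev_Cobd g) simp_all
  ultimately show "ev (m + n + 1) ?L c as = ev (m + n + 1) (?R1 + cochain_scale sA ((- 1) ^ m) ?R2) c as"
    using mcobd_mcup[OF mlin_ev[OF f] mlin_ev[OF g] len] by (simp only: ev_add ev_scale)
qed

end

lemma Cobd_add: "f \<in> Coch n \<Longrightarrow> g \<in> Coch n \<Longrightarrow> Cobd n (f + g) = Cobd n f + Cobd n g"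
  by (rule cochain_eqI[of _ "n + 1"], intro Cobd_cochain Coch_add, assumption+,
      intro Cobd_cochain Coch_add, assumption+)
    (simp add: ev_add ev_Cobd Coch_add mcobd_linear)

lemma Cobd_scale: "f \<in> Coch n \<Longrightarrow> Cobd n (cochain_scale sA r f) = cochain_scale sA r (Cobd n f)"
  by (rule cochain_eqI[of _ "n + 1"], intro Cobd_cochain Coch_scale, assumption,
      intro Cobd_cochain Coch_scale, assumption)
    (simp add: ev_scale ev_Cobd Coch_scale mcobd_linear)

lemma Cup_zero_left: "g \<in> Coch n \<Longrightarrow> Cup m n 0 g = 0"
  using Cup_add_left[of 0 m g n 0] by (simp add: Coch_zero)

lemma Cup_zero_right: "f \<in> Coch m \<Longrightarrow> Cup m n f 0 = 0"
  using Cup_add_right[of f m 0 n 0] by (simp add: Coch_zero)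

lemma Cobd_zero: "Cobd n 0 = 0"
  using Cobd_add[of 0 n 0] by (simp add: Coch_zero)

lemma Cup_sum_left:
  "g \<in> Coch n \<Longrightarrow> (\<And>i. i \<in> S \<Longrightarrow> f i \<in> Coch m) \<Longrightarrow> Cup m n (\<Sum>i\<in>S. f i) g = (\<Sum>i\<in>S. Cup m n (f i) g)"
  by (induction S rule: infinite_finite_induct) (auto simp: Cup_zero_left Cup_add_left Coch_sum)

lemma Cup_sum_right:
  "f \<in> Coch m \<Longrightarrow> (\<And>i. i \<in> S \<Longrightarrow> g i \<in> Coch n) \<Longrightarrow> Cup m n f (\<Sum>i\<in>S. g i) = (\<Sum>i\<in>S. Cup m n f (g i))"
  by (induction S rule: infinite_finite_induct) (auto simp: Cup_zero_right Cup_add_right Coch_sum)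

definition unit_cochain :: "('k, 'a, 'c) cochain" where
  "unit_cochain = lin_ext sA sC 0 munit"

lemma unit_cochain: "unit_cochain \<in> Coch 0"
  by (simp add: unit_cochain_def lin_ext_cochain mlin_munit)

lemma ev_unit_cochain: "ev 0 unit_cochain c [] = munit c []"
  by (simp add: unit_cochain_def ev_def lin_ext_puren mlin_munit)

lemma Cup_unit_left:
  assumes "f \<in> Coch n"
  shows "Cup 0 n unit_cochain f = f"
proof (rule cochain_eqI[of _ n])
  show "Cup 0 n unit_cochain f \<in> Coch n"
    using Cup_cochain[OF unit_cochain assms] by simp
  fix c and as :: "'a list"
  assume "length as = n"
  moreover from this have "mcup 0 (ev 0 unit_cochain) (ev n f) c as = mcup 0 munit (ev n f) c as"
    by (intro mcup_cong) (auto simp: ev_unit_cochain)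
  ultimately show "ev n (Cup 0 n unit_cochain f) c as = ev n f c as"
    using assms unit_cochain by (simp add: ev_Cup mcup_munit_left[OF mlin_ev])
qed (fact assms)

lemma Cup_unit_right:
  assumes "f \<in> Coch n"
  shows "Cup n 0 f unit_cochain = f"
proof (rule cochain_eqI[of _ n])
  show "Cup n 0 f unit_cochain \<in> Coch n"
    using Cup_cochain[OF assms unit_cochain] by simp
  fix c and as :: "'a list"
  assume "length as = n"
  moreover from this have "mcup n (ev n f) (ev 0 unit_cochain) c as = mcup n (ev n f) munit c as"
    by (intro mcup_cong) (auto simp: ev_unit_cochain)
  ultimately show "ev n (Cup n 0 f unit_cochain) c as = ev n f c as"
    using assms unit_cochain by (simp add: ev_Cup mcup_munit_right[OF mlin_ev])
qed (fact assms)


section \<open>The direct sum of all degrees\<close>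

abbreviation "TC \<equiv> total_cochains sA sC"
abbreviation "Hom \<equiv> homog sA sC"
abbreviation "tcup \<equiv> total_cup sA sC \<Delta> \<psi>"
abbreviation "tcobd \<equiv> total_cobd sA sC \<psi>"
abbreviation "tscale \<equiv> total_scale sA"

lemma TC_Coch: "x \<in> TC \<Longrightarrow> x n \<in> Coch n"
  by (simp add: total_cochains_def)

lemma TC_eventually_zero:
  assumes "x \<in> TC"
  obtains N where "\<And>n. n \<ge> N \<Longrightarrow> x n = 0"
proof -
  have "finite {n. x n \<noteq> 0}" using assms by (simp add: total_cochains_def)
  then obtain N where "\<And>n. n \<in> {n. x n \<noteq> 0} \<Longrightarrow> n < N"
    using finite_nat_set_iff_bounded by auto
  then show ?thesis by (intro that[of N]) force
qed

lemma TC_I: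
  assumes "\<And>n. x n \<in> Coch n" and "\<And>n. n \<ge> N \<Longrightarrow> x n = 0"
  shows "x \<in> TC"
proof -
  have "{n. x n \<noteq> 0} \<subseteq> {..<N}" using assms(2) by (force simp: not_less[symmetric])
  then show ?thesis
    using assms(1) finite_subset by (auto simp: total_cochains_def)
qed

lemma Hom_TC: "x \<in> Hom n \<Longrightarrow> x \<in> TC"
  by (rule TC_I[of _ "Suc n"]) (auto simp: homog_def intro: Coch_zero split: if_splits, metis Coch_zero)

lemma total_vector_space: "vector_space tscale"
  by unfold_locales
    (auto simp: total_scale_def cochain_scale_def fun_eq_iff A.scale_right_distrib A.scale_left_distrib)

interpretation T: vector_space tscale
  by (rule total_vector_space)

lemma tscale_apply: "tscale r x n = cochain_scale sA r (x n)"
  by (simp add: total_scale_def)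

lemma cochain_scale_zero: "cochain_scale sA r 0 = 0"
  by (auto simp: cochain_scale_def)

lemma subspace_TC: "T.subspace TC"
proof (rule T.subspaceI)
  show "0 \<in> TC" by (rule TC_I[of _ 0]) (auto intro: Coch_zero)
  show "x + y \<in> TC" if "x \<in> TC" "y \<in> TC" for x y
  proof -
    obtain N where "\<And>n. n \<ge> N \<Longrightarrow> x n = 0"
      by (rule TC_eventually_zero[OF \<open>x \<in> TC\<close>]) blast
    moreover obtain M where "\<And>n. n \<ge> M \<Longrightarrow> y n = 0"
      by (rule TC_eventually_zero[OF \<open>y \<in> TC\<close>]) blast
    ultimately show ?thesis
      using that by (intro TC_I[of _ "max N M"]) (auto intro: Coch_add TC_Coch)
  qed
  show "tscale r x \<in> TC" if "x \<in> TC" for r x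
  proof -
    obtain N where "\<And>n. n \<ge> N \<Longrightarrow> x n = 0"
      by (rule TC_eventually_zero[OF \<open>x \<in> TC\<close>]) blast
    then show ?thesis
      using that by (intro TC_I[of _ N])
        (auto simp: tscale_apply cochain_scale_zero intro: Coch_scale TC_Coch)
  qed
qed

lemma subspace_Hom: "T.subspace (Hom n)"
  by (rule T.subspaceI)
    (auto simp: homog_def tscale_apply cochain_scale_zero intro: Coch_zero Coch_add Coch_scale)

text \<open>In degree \<open>i\<close> only the summand \<open>F i\<close> contributes; both
  existence and uniqueness of the decomposition rest on this.\<close>

lemma Hom_sum_apply:
  assumes "\<And>n. F n \<in> Hom n" "finite {n. F n \<noteq> 0}"
  shows "(\<Sum>n | F n \<noteq> 0. F n) i = F i i"
proof -
  have "(\<Sum>n | F n \<noteq> 0. F n) i = (\<Sum>n | F n \<noteq> 0. if n = i then F i i else 0)"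
    using assms(1) by (subst sum_fun_apply, intro sum.cong) (auto simp: homog_def)
  also have "\<dots> = F i i" using assms(2) by (simp add: sum.delta)
  finally show ?thesis .
qed

lemma Hom_decomposition:
  assumes "x \<in> TC"
  shows "\<exists>!F. (\<forall>n. F n \<in> Hom n) \<and> finite {n. F n \<noteq> 0} \<and> x = (\<Sum>n | F n \<noteq> 0. F n)"
proof (rule ex1I)
  let ?F = "\<lambda>n i. if i = n then x n else 0"
  have F: "?F n \<in> Hom n" for n
    using TC_Coch[OF assms] by (simp add: homog_def)
  have "?F n = 0 \<longleftrightarrow> x n = 0" for n by (auto simp: fun_eq_iff)
  then have fin: "finite {n. ?F n \<noteq> 0}"
    using assms by (simp add: total_cochains_def)
  have "x = (\<Sum>n | ?F n \<noteq> 0. ?F n)"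
    using Hom_sum_apply[of ?F, OF F fin] by (intro ext) simp
  with F fin show "(\<forall>n. ?F n \<in> Hom n) \<and> finite {n. ?F n \<noteq> 0} \<and> x = (\<Sum>n | ?F n \<noteq> 0. ?F n)"
    by blast
  fix F
  assume *: "(\<forall>n. F n \<in> Hom n) \<and> finite {n. F n \<noteq> 0} \<and> x = (\<Sum>n | F n \<noteq> 0. F n)"
  then have "x i = F i i" for i
    using Hom_sum_apply[of F i] by metis
  then show "F = ?F"
    using * by (intro ext) (auto simp: homog_def)
qed

lemma tcup_Coch:
  assumes "x \<in> TC" "y \<in> TC" "i \<le> n"
  shows "Cup i (n - i) (x i) (y (n - i)) \<in> Coch n"
  using Cup_cochain[OF TC_Coch[OF assms(1), of i] TC_Coch[OF assms(2), of "n - i"]] assms(3) by simp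

lemma tcup_TC:
  assumes "x \<in> TC" "y \<in> TC"
  shows "tcup x y \<in> TC"
proof -
  obtain N where N: "\<And>n. n \<ge> N \<Longrightarrow> x n = 0"
    by (rule TC_eventually_zero[OF assms(1)]) blast
  obtain M where M: "\<And>n. n \<ge> M \<Longrightarrow> y n = 0"
    by (rule TC_eventually_zero[OF assms(2)]) blast
  show ?thesis
  proof (rule TC_I[of _ "N + M"])
    show "tcup x y n \<in> Coch n" for n
      unfolding total_cup_def by (intro Coch_sum tcup_Coch assms) simp
    fix n assume n: "n \<ge> N + M"
    \<comment> \<open>Either the left degree reaches \<open>N\<close> or the right one reaches
      \<open>M\<close>, so one factor is 0.\<close>
    have "Cup i (n - i) (x i) (y (n - i)) = 0" for i
    proof (cases "i \<ge> N")
      case True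
      then show ?thesis by (simp add: N Cup_zero_left TC_Coch assms)
    next
      case False
      then show ?thesis using n by (simp add: M Cup_zero_right TC_Coch assms)
    qed
    then show "tcup x y n = 0" by (simp add: total_cup_def)
  qed
qed

lemma tcup_add_left: "x \<in> TC \<Longrightarrow> y \<in> TC \<Longrightarrow> z \<in> TC \<Longrightarrow> tcup (x + y) z = tcup x z + tcup y z"
  and tcup_add_right: "x \<in> TC \<Longrightarrow> y \<in> TC \<Longrightarrow> z \<in> TC \<Longrightarrow> tcup x (y + z) = tcup x y + tcup x z"
  by (auto simp: total_cup_def fun_eq_iff TC_Coch Cup_add_left Cup_add_right sum.distrib)

lemma cochain_scale_sum: "cochain_scale sA r (\<Sum>i\<in>S. f i) = (\<Sum>i\<in>S. cochain_scale sA r (f i))"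
  by (simp add: cochain_scale_def fun_eq_iff sum_fun_apply A.scale_sum_right)

lemma tcup_scale:
  assumes "x \<in> TC" "y \<in> TC"
  shows "tcup (tscale r x) y = tscale r (tcup x y)" "tcup x (tscale r y) = tscale r (tcup x y)"
  using assms unfolding total_cup_def total_scale_def
  by (simp_all add: cochain_scale_sum TC_Coch Cup_scale_left Cup_scale_right)

lemma tcup_assoc:
  assumes x: "x \<in> TC" and y: "y \<in> TC" and z: "z \<in> TC"
  shows "tcup (tcup x y) z = tcup x (tcup y z)"
proof
  fix n
  have "tcup (tcup x y) z n =
      (\<Sum>j\<le>n. \<Sum>i\<le>j. Cup j (n - j) (Cup i (j - i) (x i) (y (j - i))) (z (n - j)))"
    unfolding total_cup_def
    by (intro sum.cong refl Cup_sum_left TC_Coch[OF z] tcup_Coch[OF x y]) simp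
  \<comment> \<open>Writing the degree \<open>j\<close> as \<open>i + (j - i)\<close> makes the
    summand a function of the three degrees, as \<open>sum_triple_reindex\<close> requires.\<close>
  also have "\<dots> = (\<Sum>j\<le>n. \<Sum>i\<le>j. Cup (i + (j - i)) (n - j) (Cup i (j - i) (x i) (y (j - i))) (z (n - j)))"
    by (intro sum.cong refl) simp
  also have "\<dots> = (\<Sum>i\<le>n. \<Sum>j\<le>n - i. Cup (i + j) (n - i - j) (Cup i j (x i) (y j)) (z (n - i - j)))"
    by (rule sum_triple_reindex)
  also have "\<dots> = (\<Sum>i\<le>n. \<Sum>j\<le>n - i. Cup i (n - i) (x i) (Cup j (n - i - j) (y j) (z (n - i - j))))"
    using x y z by (intro sum.cong refl) (simp add: Cup_assoc TC_Coch)
  also have "\<dots> = tcup x (tcup y z) n"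
    unfolding total_cup_def
    by (intro sum.cong refl Cup_sum_right[symmetric] TC_Coch[OF x] tcup_Coch[OF y z]) simp
  finally show "tcup (tcup x y) z n = tcup x (tcup y z) n" .
qed

section \<open>Homogeneous elements and the unit\<close>

lemma tcup_Hom_apply:
  assumes x: "x \<in> Hom m" and y: "y \<in> Hom n"
  shows "tcup x y k = (if k = m + n then Cup m n (x m) (y n) else 0)"
proof -
  \<comment> \<open>Only \<open>i = m\<close> with \<open>k - i = n\<close> can survive; every other
    term has a zero factor.\<close>
  have "Cup i (k - i) (x i) (y (k - i)) =
      (if i = m then if k = m + n then Cup m n (x m) (y n) else 0 else 0)" if "i \<le> k" for i
    using that x y Cup_zero_left[OF TC_Coch[OF Hom_TC[OF y]]]
      Cup_zero_right[OF TC_Coch[OF Hom_TC[OF x]]]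
    by (auto simp: homog_def)
  then have "tcup x y k = (\<Sum>i\<le>k. if i = m then if k = m + n then Cup m n (x m) (y n) else 0 else 0)"
    unfolding total_cup_def by (intro sum.cong) auto
  then show ?thesis by simp
qed

lemma tcup_Hom:
  assumes "x \<in> Hom m" "y \<in> Hom n"
  shows "tcup x y \<in> Hom (m + n)"
  unfolding homog_def using assms
  by (auto simp: tcup_Hom_apply[OF assms] intro!: Cup_cochain) (auto simp: homog_def)

lemma tcup_unit: "\<exists>e\<in>Hom 0. \<forall>x\<in>TC. tcup e x = x \<and> tcup x e = x"
proof (intro bexI ballI conjI)
  let ?e = "\<lambda>n. if n = 0 then unit_cochain else 0"
  show "?e \<in> Hom 0" by (simp add: homog_def unit_cochain)
  fix x assume x: "x \<in> TC"
  have "tcup ?e x n = (\<Sum>i\<le>n. if i = 0 then x n else 0)" for n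
    unfolding total_cup_def
    by (intro sum.cong) (auto simp: Cup_unit_left Cup_zero_left TC_Coch[OF x])
  then show "tcup ?e x = x" by (simp add: fun_eq_iff)
  have "tcup x ?e n = (\<Sum>i\<le>n. if i = n then x n else 0)" for n
    unfolding total_cup_def
    by (intro sum.cong) (auto simp: Cup_unit_right Cup_zero_right TC_Coch[OF x])
  then show "tcup x ?e = x" by (simp add: fun_eq_iff)
qed

section \<open>The coboundary on the direct sum\<close>

lemma tcobd_Hom_apply:
  assumes "x \<in> Hom n"
  shows "tcobd x k = (if k = n + 1 then Cobd n (x n) else 0)"
  using assms by (auto simp: total_cobd_def homog_def Cobd_zero split: nat.splits)

lemma tcobd_Hom:
  assumes "x \<in> Hom n"
  shows "tcobd x \<in> Hom (n + 1)"
  using assms Cobd_cochain[of "x n" n] by (simp add: homog_def tcobd_Hom_apply[OF assms])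

lemma tcobd_TC:
  assumes "x \<in> TC"
  shows "tcobd x \<in> TC"
proof -
  obtain N where N: "\<And>n. n \<ge> N \<Longrightarrow> x n = 0"
    by (rule TC_eventually_zero[OF assms]) blast
  show ?thesis
  proof (rule TC_I[of _ "Suc N"])
    show "tcobd x n \<in> Coch n" for n
      using Cobd_cochain[OF TC_Coch[OF assms]]
      by (cases n) (auto simp: total_cobd_def Coch_zero)
    show "tcobd x n = 0" if "n \<ge> Suc N" for n
      using that by (cases n) (auto simp: total_cobd_def N Cobd_zero)
  qed
qed

lemma tcobd_add: "x \<in> TC \<Longrightarrow> y \<in> TC \<Longrightarrow> tcobd (x + y) = tcobd x + tcobd y"
  and tcobd_scale: "x \<in> TC \<Longrightarrow> tcobd (tscale r x) = tscale r (tcobd x)"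
  by (auto simp: total_cobd_def total_scale_def cochain_scale_zero fun_eq_iff TC_Coch Cobd_add Cobd_scale
      split: nat.splits)

text \<open>Both sides are concentrated in degree \<open>m + n + 1\<close>, where the identity is
  \<open>Cobd_Cup\<close>.\<close>

lemma tcobd_tcup:
  assumes x: "x \<in> Hom m" and y: "y \<in> Hom n"
  shows "tcobd (tcup x y) = tcup (tcobd x) y + tscale ((- 1) ^ m) (tcup x (tcobd y))"
proof
  fix k
  have "x m \<in> Coch m" "y n \<in> Coch n" using x y by (simp_all add: homog_def)
  then show "tcobd (tcup x y) k = (tcup (tcobd x) y + tscale ((- 1) ^ m) (tcup x (tcobd y))) k"
    using Cobd_Cup[of "x m" m "y n" n]
    by (simp add: tcobd_Hom_apply[OF tcup_Hom[OF x y]] tcup_Hom_apply[OF x y]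
        tcup_Hom_apply[OF tcobd_Hom[OF x] y] tcup_Hom_apply[OF x tcobd_Hom[OF y]]
        tcobd_Hom_apply[OF x] tcobd_Hom_apply[OF y] tscale_apply cochain_scale_zero)
qed

lemma graded_algebra_total: "graded_algebra tscale TC Hom tcup"
  unfolding graded_algebra_def
  by (intro conjI allI ballI total_vector_space subspace_TC subspace_Hom Hom_decomposition tcup_TC
      tcup_add_left tcup_add_right tcup_scale tcup_assoc tcup_unit tcup_Hom subsetI)
    (auto intro: Hom_TC)

lemma derivation_total: "degree_one_derivation tscale TC Hom tcup tcobd"
  unfolding degree_one_derivation_def
  by (intro conjI allI ballI tcobd_TC tcobd_add tcobd_scale tcobd_Hom tcobd_tcup)

end

theorem lemma4p1:
  fixes sA :: "'k::field \<Rightarrow> 'a::{ring, monoid_mult} \<Rightarrow> 'a"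
    and sC :: "'k \<Rightarrow> 'c::ab_group_add \<Rightarrow> 'c"
    and \<Delta> :: "'c \<Rightarrow> ('c \<times> 'c \<Rightarrow>\<^sub>0 'k) set"
    and \<epsilon> :: "'c \<Rightarrow> 'k"
    and \<psi> :: "('c \<times> 'a \<Rightarrow>\<^sub>0 'k) set \<Rightarrow> ('a \<times> 'c \<Rightarrow>\<^sub>0 'k) set"
  assumes "entwining_structure sA sC \<Delta> \<epsilon> \<psi>"
  shows
    "(\<forall>m n. \<forall>f\<in>cochains sA sC m. \<forall>g\<in>cochains sA sC n.
        cup sA sC \<Delta> \<psi> m n f g \<in> cochains sA sC (m + n) \<and>
        (\<forall>c as. length as = m + n \<longrightarrow>
           cup sA sC \<Delta> \<psi> m n f g (puren sC sA (m + n) c as) = cup_formula sA sC \<Delta> \<psi> m n f g c as)) \<and>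
     (\<forall>n. \<forall>f\<in>cochains sA sC n.
        cobd sA sC \<psi> n f \<in> cochains sA sC (n + 1) \<and>
        (\<forall>c as. length as = n + 1 \<longrightarrow>
           cobd sA sC \<psi> n f (puren sC sA (n + 1) c as) = cobd_formula sA sC \<psi> n f c as)) \<and>
     graded_algebra (total_scale sA) (total_cochains sA sC) (homog sA sC) (total_cup sA sC \<Delta> \<psi>) \<and>
     degree_one_derivation (total_scale sA) (total_cochains sA sC) (homog sA sC) (total_cup sA sC \<Delta> \<psi>)
       (total_cobd sA sC \<psi>) \<and>
     (\<forall>m n. \<forall>f\<in>cochains sA sC m. \<forall>g\<in>cochains sA sC n.
        cobd sA sC \<psi> (m + n) (cup sA sC \<Delta> \<psi> m n f g) =
        cup sA sC \<Delta> \<psi> (m + 1) n (cobd sA sC \<psi> m f) g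
        + cochain_scale sA ((-1) ^ m) (cup sA sC \<Delta> \<psi> m (n + 1) f (cobd sA sC \<psi> n g)))"
proof -
  interpret entwining_structure sA sC \<Delta> \<epsilon> \<psi> by fact
  show ?thesis
    by (intro conjI allI ballI impI graded_algebra_total derivation_total Cobd_Cup Cup_cochain Cobd_cochain)
      (simp_all add: cup_formula_eq cobd_formula_eq Cup_puren Cobd_puren
        del: One_nat_def add_Suc_right Suc_eq_plus1)
qed

end
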